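(* Let $m\ge1$ be an integer. The function $\mathcal{H}^m(z)$ extends meromorphically to $\mathbb{C}$, with poles only at the points $z=1,0,-1,-2,-3,\dots$, and the orders of these poles are: order $m+1$ at $z=1$; order $m$ at $z=0$; order $m$ at each negative odd integer $z=-1,-3,-5,\dots$; order $m-1$ at each negative even integer $z=-2,-4,-6,\dots$ (where a "pole of order $0$" means the function is holomorphic at that point).
   Context: $H_n=1+\frac12+\cdots+\frac1n$ is the $n$th harmonic number and $\mathcal{H}^m(z)=\sum_{n\ge1}H_n^m n^{-z}$ for $\Re(z)>1$. *)

theory Defs
  imports "HOL-Complex_Analysis.Complex_Analysis"
begin

text \<open>The summation index is shifted by one: the \<open>n\<close>-th term here is \<open>H_{n+1}^m (n+1)^{-z}\<close>.\<close>

definition harm_dirichlet_term :: "nat \<Rightarrow> complex \<Rightarrow> nat \<Rightarrow> complex" where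
  "harm_dirichlet_term m z n = harm (Suc n) ^ m * of_nat (Suc n) powr (- z)"

definition harm_dirichlet :: "nat \<Rightarrow> complex \<Rightarrow> complex" where
  "harm_dirichlet m z = (\<Sum>n. harm_dirichlet_term m z n)"

text \<open>
  A pole of order \<open>0\<close> means holomorphy in a neighbourhood of the point, including at the point itself.
  For \<open>k > 0\<close> the definition is meant for functions meromorphic at \<open>z\<close>, where
  \<^const>\<open>zorder\<close> is minus the order of the pole.
\<close>

definition has_pole_of_order :: "(complex \<Rightarrow> complex) \<Rightarrow> complex \<Rightarrow> nat \<Rightarrow> bool" where
  "has_pole_of_order f z k \<longleftrightarrow>
     (if k = 0 then f analytic_on {z} else is_pole f z \<and> zorder f z = - int k)"

end

theory Submission
  imports Defs
begin

text \<open>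
  Write \<open>H\<^sub>n = ln n + A\<^sub>n\<close>, where \<open>A\<^sub>n\<close> has an asymptotic expansion \<open>\<Sum> a\<^sub>k n\<^bsup>-k\<^esup>\<close> with \<open>a\<^sub>0 = \<gamma>\<close>,
  \<open>a\<^sub>1 = 1/2\<close> and \<open>a\<^sub>k\<close> otherwise a nonzero multiple of the Bernoulli number \<open>B\<^sub>k\<close>. Expanding
  \<open>(ln n + A\<^sub>n)\<^sup>m\<close> turns the Dirichlet series, up to a remainder holomorphic on an arbitrarily large
  half-plane, into a finite combination of series \<open>\<Sum> (ln n)\<^sup>j n\<^bsup>-z-k\<^esup>\<close>; each of these is, up to sign,
  the \<open>j\<close>-th derivative of \<open>\<zeta>\<close> at \<open>z + k\<close>, with a pole of order \<open>j + 1\<close> at \<open>z = 1 - k\<close>. The order of the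
  pole there is therefore \<open>J + 1\<close> for the largest \<open>J\<close> such that \<open>n\<^bsup>-k\<^esup>\<close> occurs in the expansion of
  \<open>A\<^sub>n\<^bsup>m-J\<^esup>\<close>, and it is determined by the vanishing of \<open>a\<^sub>k\<close> for odd \<open>k > 1\<close> and the
  nonvanishing for even \<open>k\<close>.
\<close>

section \<open>Dirichlet series on half-planes\<close>

text \<open>Local Weierstrass M-test: a summable majorant near each point justifies termwise
  differentiation. The derivative series is kept in the conclusion because it is what later produces
  the logarithms.\<close>

lemma holomorphic_suminf:
  fixes f :: "nat \<Rightarrow> complex \<Rightarrow> complex"
  assumes "open S" and f: "\<And>n. f n holomorphic_on S"
    and bound: "\<And>x. x \<in> S \<Longrightarrow> \<exists>d h. 0 < d \<and> summable h \<and>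
            (\<forall>\<^sub>F n in sequentially. \<forall>y\<in>ball x d \<inter> S. norm (f n y) \<le> h n)"
  shows "(\<lambda>z. \<Sum>n. f n z) holomorphic_on S"
    and "\<And>z. z \<in> S \<Longrightarrow> summable (\<lambda>n. f n z)"
    and "\<And>z. z \<in> S \<Longrightarrow> summable (\<lambda>n. deriv (f n) z)"
    and "\<And>z. z \<in> S \<Longrightarrow>
           ((\<lambda>z. \<Sum>n. f n z) has_field_derivative (\<Sum>n. deriv (f n) z)) (at z)"
proof -
  have "\<exists>g g'. \<forall>x\<in>S. (\<lambda>n. f n x) sums g x \<and> (\<lambda>n. deriv (f n) x) sums g' x \<and>
                (g has_field_derivative g' x) (at x)"
    by (rule series_and_derivative_comparison_local[OF \<open>open S\<close> _ bound])
       (use f \<open>open S\<close> in \<open>auto intro: holomorphic_derivI\<close>)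
  then obtain g g' where g: "\<And>x. x \<in> S \<Longrightarrow> (\<lambda>n. f n x) sums g x"
      "\<And>x. x \<in> S \<Longrightarrow> (\<lambda>n. deriv (f n) x) sums g' x"
      "\<And>x. x \<in> S \<Longrightarrow> (g has_field_derivative g' x) (at x)"
    by metis
  show *: "((\<lambda>z. \<Sum>n. f n z) has_field_derivative (\<Sum>n. deriv (f n) z)) (at z)" if "z \<in> S" for z
    using g(3)[OF that] \<open>open S\<close> that
    by (subst sums_unique[OF g(2)[OF that], symmetric],
        rule has_field_derivative_transform_within_open)
       (use g(1) in \<open>auto simp: sums_iff\<close>)
  then show "(\<lambda>z. \<Sum>n. f n z) holomorphic_on S"
    using \<open>open S\<close> by (auto simp: holomorphic_on_open)
  show "summable (\<lambda>n. f n z)" "summable (\<lambda>n. deriv (f n) z)" if "z \<in> S" for z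
    using g that by (auto simp: sums_iff)
qed

text \<open>\<open>r n\<close> is the coefficient belonging to n + 1. Coefficients are real so that
  growth bounds and asymptotic expansions can be handled over the reals.\<close>

definition dser :: "(nat \<Rightarrow> real) \<Rightarrow> complex \<Rightarrow> complex" where
  "dser r z = (\<Sum>n. of_real (r n) * of_nat (Suc n) powr - z)"

lemma norm_of_nat_Suc_powr: "norm (of_nat (Suc n) powr z :: complex) = real (Suc n) powr Re z"
  by (subst norm_powr_real_powr) auto

lemma summable_Suc_powr: "a < -1 \<Longrightarrow> summable (\<lambda>n. real (Suc n) powr a)"
  using summable_real_powr_iff[of a] by (subst summable_Suc_iff) auto

lemma open_halfplane: "open {z. c < Re z}" and connected_halfplane: "connected {z. c < Re z}"
  by (auto simp: open_halfspace_Re_gt convex_halfspace_Re_gt intro: convex_connected)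

text \<open>Differentiating (n + 1)^(-z) brings down the factor -ln (n + 1), so the derivative is
  again a \<open>dser\<close>. In this way all powers of the logarithm are generated from
  zeta.\<close>

lemma dser_properties:
  fixes r :: "nat \<Rightarrow> real"
  assumes r: "r \<in> O(\<lambda>n. real (Suc n) powr c)" and z: "Re z > c + 1"
  shows "(\<lambda>n. of_real (r n) * of_nat (Suc n) powr - z) sums dser r z"
    and "(dser r has_field_derivative
            - dser (\<lambda>n. r n * ln (real (Suc n))) z) (at z)"
proof -
  define S where "S = {z. c + 1 < Re z}"
  define f :: "nat \<Rightarrow> complex \<Rightarrow> complex" where "f = (\<lambda>n z. of_real (r n) * of_nat (Suc n) powr - z)"
  have S: "open S" "z \<in> S" using z by (simp_all add: S_def open_halfplane)
  have f: "f n holomorphic_on S" for n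
    unfolding f_def by (intro holomorphic_intros)
  have d: "(f n has_field_derivative - (of_real (r n * ln (real (Suc n))) * of_nat (Suc n) powr - w)) (at w)"
    for n w
  proof -
    have "((\<lambda>z. of_nat (Suc n) powr - z) has_field_derivative
             Ln (of_nat (Suc n)) * of_nat (Suc n) powr - w * (-1)) (at w)"
      by (rule DERIV_chain2[OF has_field_derivative_powr_right])
         (auto intro!: derivative_eq_intros simp del: of_nat_Suc)
    from DERIV_cmult[OF this, of "of_real (r n)"] show ?thesis
      by (simp add: f_def Ln_of_nat mult_ac del: of_nat_Suc)
  qed
  have bound: "\<exists>d h. 0 < d \<and> summable h \<and>
            (\<forall>\<^sub>F n in sequentially. \<forall>y\<in>ball x d \<inter> S. norm (f n y) \<le> h n)" if x: "x \<in> S" for x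
  proof -
    \<comment> \<open>Half the distance to the boundary line: on the whole ball the terms have
      exponent at most c - Re x + d < -1, which gives a single majorant.\<close>
    obtain d where d: "d > 0" "c + 1 < Re x - d"
      using x by (intro that[of "(Re x - c - 1) / 2"]) (auto simp: S_def field_simps)
    obtain C where C: "C > 0" "\<forall>\<^sub>F n in sequentially. norm (r n) \<le> C * norm (real (Suc n) powr c)"
      using r by (elim landau_o.bigE) auto
    have "summable (\<lambda>n. C * real (Suc n) powr (c - Re x + d))"
      using d by (intro summable_mult summable_Suc_powr) auto
    moreover have "\<forall>\<^sub>F n in sequentially. \<forall>y\<in>ball x d \<inter> S.
        norm (f n y) \<le> C * real (Suc n) powr (c - Re x + d)"
      using C(2)
    proof eventually_elim
      case (elim n)
      show ?case
      proof
        fix y assume "y \<in> ball x d \<inter> S"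
        hence "dist x y < d" by simp
        hence "\<bar>Re (x - y)\<bar> < d" 
          using abs_Re_le_cmod[of "x - y"] by (simp add: dist_norm)
        hence y: "- Re y \<le> - Re x + d" by simp
        have "norm (f n y) = norm (r n) * real (Suc n) powr - Re y"
          by (simp add: f_def norm_mult norm_of_nat_Suc_powr del: of_nat_Suc)
        also have "\<dots> \<le> (C * real (Suc n) powr c) * real (Suc n) powr (- Re x + d)"
          using elim y C by (intro mult_mono powr_mono) auto
        finally show "norm (f n y) \<le> C * real (Suc n) powr (c - Re x + d)"
          by (simp add: powr_add [symmetric] mult.assoc algebra_simps)
      qed
    qed
    ultimately show ?thesis using d by blast
  qed
  have sums: "summable (\<lambda>n. f n z)" "summable (\<lambda>n. deriv (f n) z)"
    and deriv: "((\<lambda>z. \<Sum>n. f n z) has_field_derivative (\<Sum>n. deriv (f n) z)) (at z)"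
    by (rule holomorphic_suminf(2-)[OF S(1) f bound S(2)]; assumption)+
  show "(\<lambda>n. of_real (r n) * of_nat (Suc n) powr - z) sums dser r z"
    using sums(1) unfolding f_def dser_def by (simp add: summable_sums)
  have "deriv (f n) z = - (of_real (r n * ln (real (Suc n))) * of_nat (Suc n) powr - z)" for n
    using d by (rule DERIV_imp_deriv)
  moreover from this have "summable (\<lambda>n. - (of_real (r n * ln (real (Suc n))) * of_nat (Suc n) powr - z))"
    using sums(2) by simp
  ultimately show "(dser r has_field_derivative
            - dser (\<lambda>n. r n * ln (real (Suc n))) z) (at z)"
    using deriv unfolding summable_minus_iff
    by (simp add: suminf_minus dser_def[abs_def] f_def)
qed

lemma holomorphic_on_dser:
  assumes "r \<in> O(\<lambda>n. real (Suc n) powr c)"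
  shows "dser r holomorphic_on {z. Re z > c + 1}"
  using dser_properties(2)[OF assms] by (subst holomorphic_on_open) (auto simp: open_halfplane)

text \<open>By the identity theorem, consecutive functions that agree for Re z > 1 agree on the
  larger half-plane. Holomorphy is asked only of the differences, so that the functions themselves
  may share poles.\<close>

lemma halfplane_glue:
  fixes f :: "nat \<Rightarrow> complex \<Rightarrow> complex"
  assumes hol: "\<And>n. (\<lambda>z. f (Suc n) z - f n z) holomorphic_on {z. - real n < Re z}"
    and eq: "\<And>n z. Re z > 1 \<Longrightarrow> f n z = f 0 z"
  obtains F where "\<And>n z. Re z > - real n \<Longrightarrow> F z = f n z"
proof -
  have step: "f (Suc n) z = f n z" if "Re z > - real n" for n z
  proof -
    have 1: "{z. 1 < Re z} \<noteq> {}" by (auto intro: exI[of _ 2])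
    have 2: "{z. 1 < Re z} \<subseteq> {z. - real n < Re z}" by auto
    have 3: "f (Suc n) w - f n w = 0" if "w \<in> {z. 1 < Re z}" for w
      using eq[of w "Suc n"] eq[of w n] that by simp
    have "f (Suc n) z - f n z = 0"
      using that analytic_continuation_open[OF open_halfplane open_halfplane 1 connected_halfplane 2 hol
            holomorphic_on_const 3] by simp
    thus ?thesis by simp
  qed
  have mono: "f (n + k) z = f n z" if "Re z > - real n" for n k z
  proof (induction k)
    case (Suc k)
    thus ?case using step[of "n + k" z] that by simp
  qed auto
  define N where "N = (\<lambda>z::complex. LEAST n. Re z > - real n)"
  have "f (N z) z = f n z" if "Re z > - real n" for n z
  proof -
    have "Re z > - real (N z)" "N z \<le> n"
      unfolding N_def using that by (rule LeastI Least_le)+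
    thus ?thesis using mono[of "N z" z "n - N z"] by simp
  qed
  thus ?thesis by (rule that[of "\<lambda>z. f (N z) z"])
qed

section \<open>Continuation of the zeta series\<close>

text \<open>Taylor expansion of y^(-s) at n + 1 with step 1. The hypothesis on Re s makes the
  modulus of the next derivative decreasing in y, so on the segment it is largest at the left
  end.\<close>

lemma powr_Taylor_bound:
  fixes s :: complex
  assumes s: "Re s + real k + 1 \<ge> 0"
  shows "norm (of_nat (Suc (Suc n)) powr - s -
           (\<Sum>i\<le>k. (-1) ^ i * pochhammer s i / fact i * of_nat (Suc n) powr (- (s + of_nat i))))
         \<le> norm (pochhammer s (Suc k)) * real (Suc n) powr (- Re s - real k - 1)"
proof -
  \<comment> \<open>\<open>f i\<close> is the i-th derivative of y^(-s) with respect to y.\<close>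
  define f :: "nat \<Rightarrow> complex \<Rightarrow> complex" where
    "f = (\<lambda>i y. (-1) ^ i * pochhammer s i * y powr (- (s + of_nat i)))"
  define S :: "complex set" where "S = of_real ` {real (Suc n)..real (Suc (Suc n))}"
  have S_eq: "S = closed_segment (of_real (real (Suc n))) (of_real (real (Suc (Suc n))))"
    unfolding S_def closed_segment_of_real by (simp add: closed_segment_eq_real_ivl)
  have deriv: "(f i has_field_derivative f (Suc i) x) (at x within S)" if x: "x \<in> S" for i x
  proof -
    have "x \<notin> \<real>\<^sub>\<le>\<^sub>0" using x by (auto simp: S_def complex_nonpos_Reals_iff)
    hence "(f i has_field_derivative ((-1) ^ i * pochhammer s i *
              (- (s + of_nat i) * x powr (- (s + of_nat i) - 1)))) (at x)"
      unfolding f_def by (intro DERIV_cmult has_field_derivative_powr)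
    also have "(-1) ^ i * pochhammer s i * (- (s + of_nat i) * x powr (- (s + of_nat i) - 1)) = f (Suc i) x"
      by (simp add: f_def pochhammer_Suc algebra_simps)
    finally show ?thesis by (rule has_field_derivative_at_within)
  qed
  have bound: "norm (f (Suc k) x) \<le> norm (pochhammer s (Suc k)) * real (Suc n) powr (- Re s - real k - 1)"
    if x: "x \<in> S" for x
  proof -
    obtain y where y: "x = of_real y" "y \<ge> real (Suc n)" using x by (auto simp: S_def)
    hence "norm (f (Suc k) x) = norm (pochhammer s (Suc k)) * y powr (- Re s - real k - 1)"
      by (simp add: f_def norm_mult norm_power norm_powr_real_powr algebra_simps)
    also have "\<dots> \<le> norm (pochhammer s (Suc k)) * real (Suc n) powr (- Re s - real k - 1)"
      using y s by (intro mult_left_mono powr_mono2') auto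
    finally show ?thesis .
  qed
  have "norm (f 0 (of_real (real (Suc (Suc n)))) - (\<Sum>i\<le>k. f i (of_real (real (Suc n))) *
          (of_real (real (Suc (Suc n))) - of_real (real (Suc n))) ^ i / fact i))
        \<le> norm (pochhammer s (Suc k)) * real (Suc n) powr (- Re s - real k - 1) *
          norm (of_real (real (Suc (Suc n))) - of_real (real (Suc n)) :: complex) ^ Suc k / fact k"
    by (rule complex_Taylor[where S = S]) (use deriv bound in \<open>auto simp: S_eq convex_closed_segment\<close>)
  also have "\<dots> = norm (pochhammer s (Suc k)) * real (Suc n) powr (- Re s - real k - 1) / fact k"
    by (simp flip: of_real_diff)
  also have "\<dots> \<le> norm (pochhammer s (Suc k)) * real (Suc n) powr (- Re s - real k - 1) / 1"
    by (intro divide_left_mono fact_ge_1) auto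
  also have "f 0 (of_real (real (Suc (Suc n)))) - (\<Sum>i\<le>k. f i (of_real (real (Suc n))) *
          (of_real (real (Suc (Suc n))) - of_real (real (Suc n))) ^ i / fact i) =
        of_nat (Suc (Suc n)) powr - s -
           (\<Sum>i\<le>k. (-1) ^ i * pochhammer s i / fact i * of_nat (Suc n) powr (- (s + of_nat i)))"
    by (simp add: f_def mult_ac flip: of_real_diff)
  finally show ?thesis by simp
qed

text \<open>The summands are O(n^(-Re s - k - 1)) locally uniformly in s, which is summable exactly
  when Re s > -k.\<close>

lemma powr_remainder_holomorphic:
  fixes k :: nat
  defines "g \<equiv> \<lambda>n s. of_nat (Suc (Suc n)) powr - s -
           (\<Sum>i\<le>k. (-1) ^ i * pochhammer s i / fact i * of_nat (Suc n) powr (- (s + of_nat i)) :: complex)"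
  shows "(\<lambda>s. \<Sum>n. g n s) holomorphic_on {s. - real k < Re s}"
proof (rule holomorphic_suminf[OF open_halfplane])
  show "g n holomorphic_on {s. - real k < Re s}" for n
    unfolding g_def by (intro holomorphic_intros) auto
next
  fix x :: complex assume x: "x \<in> {s. - real k < Re s}"
  obtain d where d: "d > 0" "- real k < Re x - d"
    using x by (intro that[of "(Re x + real k) / 2"]) (auto simp: field_simps)
  \<comment> \<open>The Taylor bound still depends on s through the Pochhammer factor; compactness
    of the closed ball makes it uniform.\<close>
  have "bounded ((\<lambda>s::complex. pochhammer s (Suc k)) ` cball x d)"
    by (intro compact_imp_bounded compact_continuous_image continuous_intros compact_cball)
  then obtain B where "\<forall>y\<in>cball x d. norm (pochhammer y (Suc k)) \<le> B"
    by (auto simp: bounded_iff)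
  hence B: "\<And>y. y \<in> cball x d \<Longrightarrow> norm (pochhammer y (Suc k)) \<le> B"
    by blast
  hence "B \<ge> 0" using d(1) by (meson centre_in_cball less_imp_le norm_ge_zero order_trans)
  define h where "h = (\<lambda>n. B * real (Suc n) powr (- (Re x - d) - real k - 1))"
  have "summable h"
    unfolding h_def using d by (intro summable_mult summable_Suc_powr) auto
  moreover have "norm (g n y) \<le> h n" if y: "y \<in> ball x d" for n y
  proof -
    have "\<bar>Re (x - y)\<bar> < d"
      using abs_Re_le_cmod[of "x - y"] y by (simp add: dist_norm)
    hence Re: "Re y > Re x - d" by simp
    have "norm (g n y) \<le> norm (pochhammer y (Suc k)) * real (Suc n) powr (- Re y - real k - 1)"
      unfolding g_def by (rule powr_Taylor_bound) (use Re d in auto)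
    also have "\<dots> \<le> h n"
      unfolding h_def using Re y B[of y] \<open>B \<ge> 0\<close> by (intro mult_mono powr_mono) auto
    finally show ?thesis .
  qed
  ultimately show "\<exists>d h. 0 < d \<and> summable h \<and>
            (\<forall>\<^sub>F n in sequentially. \<forall>y\<in>ball x d \<inter> {s. - real k < Re s}. norm (g n y) \<le> h n)"
    using d(1) by (intro exI[of _ d] exI[of _ h]) auto
qed

definition zeta_series :: "complex \<Rightarrow> complex" where
  "zeta_series = dser (\<lambda>_. 1)"

lemma zeta_series_sums:
  assumes "Re s > 1"
  shows "(\<lambda>n. of_nat (Suc n) powr - s) sums zeta_series s"
  using dser_properties(1)[of "\<lambda>_. 1" 0 s] assms by (simp add: zeta_series_def)

text \<open>
  Obtained by summing the Taylor expansion of \<open>(n + 1)\<^bsup>-s\<^esup>\<close> around \<open>n\<close>; the terms for \<open>i = 0\<close>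
  telescope to \<open>1\<close>. It expresses \<open>\<zeta>(s + 1)\<close> by values further to the right.
\<close>

lemma zeta_series_recurrence:
  fixes s :: complex
  assumes s: "Re s > 1"
  shows "s * zeta_series (s + 1) =
     1 + (\<Sum>n. of_nat (Suc (Suc n)) powr - s -
           (\<Sum>i\<le>Suc k. (-1) ^ i * pochhammer s i / fact i * of_nat (Suc n) powr (- (s + of_nat i)))) +
     (\<Sum>j<k. (-1) ^ j * pochhammer s (j + 2) / fact (j + 2) * zeta_series (s + of_nat (j + 2)))"
proof -
  have 1: "(\<lambda>n. of_nat (Suc (Suc n)) powr - s) sums (zeta_series s - 1)"
    using zeta_series_sums[OF s] by (subst sums_Suc_iff) simp
  have 2: "(\<lambda>n. \<Sum>i\<le>Suc k. (-1) ^ i * pochhammer s i / fact i * of_nat (Suc n) powr (- (s + of_nat i))) sums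
          (\<Sum>i\<le>Suc k. (-1) ^ i * pochhammer s i / fact i * zeta_series (s + of_nat i))"
    by (intro sums_sum sums_mult zeta_series_sums) (use s in auto)
  have 3: "(\<Sum>i\<le>Suc k. (-1) ^ i * pochhammer s i / fact i * zeta_series (s + of_nat i)) =
        zeta_series s - s * zeta_series (s + 1) +
        (\<Sum>j<k. (-1) ^ j * pochhammer s (j + 2) / fact (j + 2) * zeta_series (s + of_nat (j + 2)))"
    unfolding lessThan_Suc_atMost [symmetric] sum.lessThan_Suc_shift by simp
  show ?thesis
    using sums_unique[OF sums_diff[OF 1 2]] unfolding 3 by (simp add: algebra_simps)
qed

text \<open>The recurrence expresses s zeta(s + 1) by zeta at points at least 2 to the right of s.
  Knowing Z for Re s > 1 - k thus gives the right-hand side for Re s > -k - 1; division by s and a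
  shift by 1 gain one strip.\<close>

lemma zeta_series_continuation_step:
  assumes Z: "Z holomorphic_on {s. 1 - real k < Re s}"
    and eq: "\<And>s. Re s > 1 \<Longrightarrow> zeta_series s = 1 / (s - 1) + Z s"
  obtains Z' where "Z' holomorphic_on {s. - real k < Re s}"
    and "\<And>s. Re s > 1 \<Longrightarrow> zeta_series s = 1 / (s - 1) + Z' s"
proof -
  define R :: "complex \<Rightarrow> complex" where
    "R = (\<lambda>s. \<Sum>n. of_nat (Suc (Suc n)) powr - s -
           (\<Sum>i\<le>Suc k. (-1) ^ i * pochhammer s i / fact i * of_nat (Suc n) powr (- (s + of_nat i))))"
  \<comment> \<open>The continuation of s zeta(s + 1). The pole 1/(s + j + 1) of zeta(s + j + 2)
    cancels against the last factor of \<open>pochhammer s (j + 2)\<close>, leaving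
    \<open>pochhammer s (j + 1)\<close>.\<close>
  define P where "P = (\<lambda>s. 1 + R s + (\<Sum>j<k. (-1) ^ j / fact (j + 2) *
       (pochhammer s (j + 1) + pochhammer s (j + 2) * Z (s + of_nat (j + 2)))))"
  define U where "U = {s. - real (Suc k) < Re s}"
  have U: "open U" unfolding U_def by (rule open_halfplane)
  have R: "R holomorphic_on U"
    unfolding R_def U_def by (rule powr_remainder_holomorphic)
  have Zs: "(\<lambda>s. Z (s + of_nat (j + 2))) holomorphic_on U" for j
    by (rule holomorphic_on_compose_gen[OF _ Z, unfolded o_def])
       (auto intro!: holomorphic_intros simp: U_def)
  have P: "P holomorphic_on U"
    unfolding P_def by (intro holomorphic_intros R Zs) auto
  \<comment> \<open>This value is the residue of zeta at 1: at s = 0 all Taylor remainders and all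
    Pochhammer factors vanish.\<close>
  have "P 0 = 1"
    by (simp add: P_def R_def pochhammer_0_left sum.atMost_shift del: of_nat_Suc)
  have P_eq: "P s = s * zeta_series (s + 1)" if s: "Re s > 1" for s
  proof -
    have *: "pochhammer s (j + 2) * zeta_series (s + of_nat (j + 2)) =
            pochhammer s (j + 1) + pochhammer s (j + 2) * Z (s + of_nat (j + 2))" for j
    proof -
      have "s + of_nat (j + 1) \<noteq> 0"
        using s by (auto simp: complex_eq_iff)
      thus ?thesis
        using s by (subst eq) (auto simp: pochhammer_Suc field_simps)
    qed
    show ?thesis
      unfolding zeta_series_recurrence[OF s, of k] P_def R_def * [symmetric] by (simp add: mult.assoc)
  qed
  define Q where "Q = (\<lambda>s. if s = 0 then deriv P 0 else (P s - P 0) / (s - 0))"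
  define Z' where "Z' = (\<lambda>s. Q (s - 1))"
  have Q: "Q holomorphic_on U"
    unfolding Q_def by (rule pole_lemma_open[OF P U])
  have Z': "Z' holomorphic_on {s. - real k < Re s}"
    unfolding Z'_def by (rule holomorphic_on_compose_gen[OF _ Q, unfolded o_def])
       (auto intro!: holomorphic_intros simp: U_def)
  \<comment> \<open>The recurrence is applied at s - 1 and so needs Re s > 2; the identity theorem
    then extends the equality to Re s > 1.\<close>
  have Z'_eq: "Z' s = Z s" if "Re s > 2" for s
  proof -
    have "s \<noteq> 1" using that by auto
    moreover have "P (s - 1) = (s - 1) * (1 / (s - 1) + Z s)"
      using P_eq[of "s - 1"] eq[of s] that by simp
    hence "P (s - 1) = 1 + (s - 1) * Z s"
      using \<open>s \<noteq> 1\<close> by (simp add: distrib_left)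
    ultimately show ?thesis using \<open>P 0 = 1\<close>
      by (simp add: Z'_def Q_def)
  qed
  have Z'_eq': "Z' s = Z s" if s: "Re s > 1" for s
  proof -
    have 1: "{z. 2 < Re z} \<noteq> {}" by (auto intro: exI[of _ 3])
    have 2: "{z. 2 < Re z} \<subseteq> {z. 1 < Re z}" by auto
    have 3: "Z' w = Z w" if "w \<in> {z. 2 < Re z}" for w using Z'_eq that by simp
    have "Z holomorphic_on {z. 1 < Re z}" "Z' holomorphic_on {z. 1 < Re z}"
      by (rule holomorphic_on_subset[OF Z] holomorphic_on_subset[OF Z']; force)+
    from analytic_continuation_open[OF open_halfplane open_halfplane 1 connected_halfplane 2 this(2,1) 3]
    show ?thesis using s by simp
  qed
  show ?thesis by (rule that[OF Z']) (use eq Z'_eq' in auto)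
qed

lemma zeta_series_continuation:
  obtains Z where "Z holomorphic_on UNIV"
    and "\<And>s. Re s > 1 \<Longrightarrow> zeta_series s = 1 / (s - 1) + Z s"
proof -
  have "\<exists>Z. Z holomorphic_on {s. 1 - real k < Re s} \<and>
            (\<forall>s. Re s > 1 \<longrightarrow> zeta_series s = 1 / (s - 1) + Z s)" for k
  proof (induction k)
    case 0
    have "zeta_series holomorphic_on {s. 1 < Re s}"
      using holomorphic_on_dser[of "\<lambda>_. 1" 0] by (simp add: zeta_series_def)
    hence "(\<lambda>s. zeta_series s - 1 / (s - 1)) holomorphic_on {s. 1 - real 0 < Re s}"
      by (auto intro!: holomorphic_intros)
    thus ?case by (intro exI[of _ "\<lambda>s. zeta_series s - 1 / (s - 1)"]) auto
  next
    case (Suc k)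
    then obtain Z where Z: "Z holomorphic_on {s. 1 - real k < Re s}"
      "\<And>s. Re s > 1 \<Longrightarrow> zeta_series s = 1 / (s - 1) + Z s" by blast
    then obtain Z' where "Z' holomorphic_on {s. - real k < Re s}"
      "\<And>s. Re s > 1 \<Longrightarrow> zeta_series s = 1 / (s - 1) + Z' s"
      using zeta_series_continuation_step[OF Z] by blast
    thus ?case by auto
  qed
  then obtain f where f: "\<And>k. f k holomorphic_on {s. 1 - real k < Re s}"
      "\<And>k s. Re s > 1 \<Longrightarrow> zeta_series s = 1 / (s - 1) + f k s"
    by metis
  \<comment> \<open>The index shift turns the half-planes Re s > 1 - k into the form Re s > -n
    expected by \<open>halfplane_glue\<close>.\<close>
  define g where "g = (\<lambda>n. f (Suc n))"
  have g: "g n holomorphic_on {z. - real n < Re z}" for n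
    using f(1)[of "Suc n"] by (simp add: g_def)
  have g': "(\<lambda>z. g (Suc n) z - g n z) holomorphic_on {z. - real n < Re z}" for n
    by (intro holomorphic_intros g holomorphic_on_subset[OF g[of "Suc n"]]) auto
  have g_eq: "g n z = g 0 z" if "Re z > 1" for n z
    using f(2)[OF that, of "Suc n"] f(2)[OF that, of "Suc 0"] by (simp add: g_def)
  obtain Z where Z: "\<And>n z. Re z > - real n \<Longrightarrow> Z z = g n z"
    using halfplane_glue[of g, OF g' g_eq] by blast
  have "Z holomorphic_on {z. - real n < Re z}" for n
    using g[of n] by (rule holomorphic_transform) (simp add: Z)
  hence "Z holomorphic_on (\<Union>n. {z. - real n < Re z})"
    by (intro holomorphic_on_UN_open open_halfplane) auto
  moreover have "(\<Union>n. {z. - real n < Re z}) = UNIV"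
  proof -
    have "\<exists>n. - real n < Re z" for z
      using reals_Archimedean2[of "- Re z"] by (auto simp: minus_less_iff)
    thus ?thesis by auto
  qed
  ultimately have "Z holomorphic_on UNIV" by simp
  thus ?thesis
    by (rule that) (use Z[of 0] f(2)[of _ "Suc 0"] in \<open>auto simp: g_def\<close>)
qed

section \<open>Coefficients of the asymptotic expansion of the harmonic numbers\<close>

text \<open>The series of (e^t - 1)/t; its inverse t/(e^t - 1) generates the Bernoulli
  numbers.\<close>

definition exp_quot :: "real fps" where
  "exp_quot = Abs_fps (\<lambda>n. 1 / fact (Suc n))"

text \<open>This is the series of \<open>1 / t - 1 / (e\<^sup>t - 1)\<close>.\<close>

definition bern_fps :: "real fps" where
  "bern_fps = fps_shift 1 (1 - inverse exp_quot)"

lemma X_mult_exp_quot: "fps_X * exp_quot = fps_exp 1 - 1"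
  by (rule fps_ext) (auto simp: exp_quot_def fps_exp_def simp del: fact_Suc)

lemma inverse_mult_exp_quot: "inverse exp_quot * exp_quot = 1"
  by (rule inverse_mult_eq_1) (simp add: exp_quot_def)

lemma X_mult_bern_fps: "fps_X * bern_fps = 1 - inverse exp_quot"
  unfolding bern_fps_def fps_shift_times_fps_X'[symmetric]
  by (rule fps_ext) (auto simp: exp_quot_def)

lemma bern_fps_mult_exp_quot: "bern_fps * exp_quot = Abs_fps (\<lambda>n. 1 / fact (n + 2))"
proof -
  have "fps_X * (bern_fps * exp_quot) = exp_quot - 1"
    by (simp add: mult.assoc [symmetric] X_mult_bern_fps ring_distribs inverse_mult_exp_quot)
  also have "\<dots> = fps_X * Abs_fps (\<lambda>n. 1 / fact (n + 2))"
    by (rule fps_ext) (auto simp: exp_quot_def simp del: fact_Suc)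
  finally show ?thesis by simp
qed

text \<open>I = t/(e^t - 1) satisfies I - t I' = I^2 + t I; substituting I = 1 - t B and cancelling
  one factor t gives the equation for B. It serves to determine the signs of the Bernoulli
  numbers.\<close>

lemma bern_fps_Riccati:
  "fps_X * fps_deriv bern_fps + 2 * bern_fps = 1 - fps_X * bern_fps + fps_X * bern_fps ^ 2"
proof -
  define E I D B where "E = exp_quot" and "I = inverse exp_quot" and "D = fps_deriv bern_fps"
    and "B = bern_fps"
  have IE: "I * E = 1" unfolding I_def E_def by (rule inverse_mult_exp_quot)
  have "fps_deriv (fps_X * E) = 1 + fps_X * E"
    unfolding E_def X_mult_exp_quot by simp
  hence E': "E + fps_X * fps_deriv E = 1 + fps_X * E" by (simp add: add_ac)
  have "fps_deriv (I * E) = 0" unfolding IE by simp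
  hence I': "I * fps_deriv E + fps_deriv I * E = 0" by (simp add: add_ac)
  have I: "I = 1 - fps_X * B" unfolding I_def B_def X_mult_bern_fps by simp
  have dI: "fps_deriv I = - (B + fps_X * D)" unfolding I by (simp add: D_def B_def)
  have "I - fps_X * fps_deriv I = I ^ 2 + fps_X * I" using E' I' IE by algebra
  hence "fps_X * (fps_X * D + 2 * B) = fps_X * (1 - fps_X * B + fps_X * B ^ 2)"
    unfolding dI unfolding I by (simp add: algebra_simps power2_eq_square)
  thus ?thesis by (simp add: B_def D_def)
qed

lemma bern_fps_0: "bern_fps $ 0 = 1 / 2"
proof -
  have "(fps_X * fps_deriv bern_fps + 2 * bern_fps) $ 0 = 1"
    unfolding bern_fps_Riccati by simp
  thus ?thesis by simp
qed

text \<open>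
  After subtracting the constant term, the Riccati equation becomes \<open>t P' + 2 P = t (P\<^sup>2 - 1/4)\<close>,
  a quadratic recurrence that preserves both the parity and the alternating signs.
\<close>

lemma bern_fps_parity_sign:
  "n > 0 \<Longrightarrow> (if even n then bern_fps $ n = 0 else (-1) ^ (Suc n div 2) * bern_fps $ n > 0)"
proof (induction n rule: less_induct)
  case (less n)
  define P where "P = bern_fps - fps_const (1 / 2)"
  have P_nth: "P $ k = (if k = 0 then 0 else bern_fps $ k)" for k
    by (auto simp: P_def bern_fps_0)
  have "bern_fps = P + fps_const (1 / 2)" by (simp add: P_def)
  have half: "2 * fps_const (1 / 2) = (1 :: real fps)" 
    by (simp add: numeral_fps_const)
  have quarter: "fps_const (1 / 2) ^ 2 = (fps_const (1 / 4) :: real fps)"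
    by (simp add: power2_eq_square)
  have "fps_X * fps_deriv P + 2 * P = fps_X * (P ^ 2 - fps_const (1 / 4))"
    using bern_fps_Riccati half quarter unfolding \<open>bern_fps = _\<close> fps_deriv_add fps_deriv_const
    by algebra
  hence "(fps_X * fps_deriv P + 2 * P) $ n = (fps_X * (P ^ 2 - fps_const (1 / 4))) $ n" by simp
  moreover obtain m where m: "n = Suc m" using less.prems by (cases n) auto
  moreover have "(P ^ 2) $ m = (\<Sum>i\<le>m. P $ i * P $ (m - i))"
    by (simp add: power2_eq_square fps_mult_nth atLeast0AtMost)
  ultimately have rec: "(real m + 3) * bern_fps $ n = (\<Sum>i\<le>m. P $ i * P $ (m - i)) - (if m = 0 then 1 / 4 else 0)"
    by (simp add: numeral_fps_const algebra_simps)
       (auto simp: P_nth algebra_simps)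
  show ?case
  proof (cases "even n")
    case True
    have "P $ i * P $ (m - i) = 0" if "i \<le> m" for i
    proof -
      \<comment> \<open>The two indices add up to the odd number m, so one of them is even, and
        \<open>P\<close> vanishes at all smaller even indices, including 0.\<close>
      have "even i \<or> even (m - i)" using True that m by auto
      hence "P $ i = 0 \<or> P $ (m - i) = 0"
      proof
        assume "even i"
        thus ?thesis using less.IH[of i] that m by (auto simp: P_nth)
      next
        assume "even (m - i)"
        hence "P $ (m - i) = 0"
          using less.IH[of "m - i"] that m by (simp add: P_nth)
        thus ?thesis ..
      qed
      thus ?thesis by simp
    qed
    hence "(\<Sum>i\<le>m. P $ i * P $ (m - i)) = 0" by (intro sum.neutral) auto
    moreover have "m \<noteq> 0" using True m by (auto dest: odd_pos)
    ultimately show ?thesis using rec True by (simp add: add_nonneg_eq_0_iff)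
  next
    case False
    have "even m" using False m by auto
    define s where "s = (-1::real) ^ (Suc n div 2)"
    have pos: "s * (P $ i * P $ (m - i)) > 0" if "i \<le> m" "odd i" for i
    proof -
      have "odd (m - i)" using that \<open>even m\<close> by auto
      moreover from this have "i > 0" "m - i > 0" using that by (simp_all add: odd_pos del: zero_less_diff)
      ultimately have "(-1) ^ (Suc i div 2) * P $ i > 0" "(-1) ^ (Suc (m - i) div 2) * P $ (m - i) > 0"
        using less.IH[of i] less.IH[of "m - i"] that m by (auto simp: P_nth)
      from mult_pos_pos[OF this] 
      have "(-1) ^ (Suc i div 2 + Suc (m - i) div 2) * (P $ i * P $ (m - i)) > 0"
        by (simp add: power_add mult_ac)
      \<comment> \<open>The sign exponents of the two factors add up to the same value for every odd
        i, so the products cannot cancel.\<close>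
      also have "Suc i div 2 + Suc (m - i) div 2 = Suc n div 2"
        using that \<open>even m\<close> m by (elim evenE oddE) auto
      finally show ?thesis by (simp add: s_def)
    qed
    have zero: "P $ i = 0" if "i \<le> m" "even i" for i
      using less.IH[of i] that m by (auto simp: P_nth)
    have "s * (\<Sum>i\<le>m. P $ i * P $ (m - i)) - s * (if m = 0 then 1 / 4 else 0) > 0"
    proof (cases "m = 0")
      case True
      \<comment> \<open>Here n = 1: the convolution is 0 and the sign comes from the term -1/4
        alone.\<close>
      thus ?thesis using m by (simp add: s_def P_nth)
    next
      case nz: False
      have "(\<Sum>i\<le>m. s * (P $ i * P $ (m - i))) > 0"
      proof (rule sum_pos2[of _ 1])
        show "0 < s * (P $ 1 * P $ (m - 1))" using pos[of 1] nz by simp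
        show "0 \<le> s * (P $ i * P $ (m - i))" if "i \<in> {..m}" for i
          using pos[of i] zero[of i] that by (cases "even i") auto
      qed (use nz in auto)
      thus ?thesis using nz by (simp add: sum_distrib_left)
    qed
    hence "s * ((real m + 3) * bern_fps $ n) > 0"
      unfolding rec by (simp add: algebra_simps)
    hence "(real m + 3) * (s * bern_fps $ n) > 0" by (simp add: mult_ac)
    hence "s * bern_fps $ n > 0" by (rule zero_less_mult_pos) simp
    thus ?thesis using False by (simp add: s_def)
  qed
qed

text \<open>Formally H_n - ln n - gamma is the integral of (1/t - 1/(e^t - 1)) e^(-nt) over t > 0,
  and integrating t^(k-1) e^(-nt) gives (k-1)!/n^k. The proof verifies the coefficients through the
  increments of the sequence instead.\<close>

definition harm_fps :: "real fps" where
  "harm_fps = Abs_fps (\<lambda>k. if k = 0 then euler_mascheroni else fact (k - 1) * bern_fps $ (k - 1))"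

lemma harm_fps_1: "harm_fps $ 1 = 1 / 2"
  by (simp add: harm_fps_def bern_fps_0)

lemma harm_fps_odd: "odd k \<Longrightarrow> k \<noteq> 1 \<Longrightarrow> harm_fps $ k = 0"
  using bern_fps_parity_sign[of "k - 1"] by (auto simp: harm_fps_def elim!: oddE)

lemma harm_fps_even: "even k \<Longrightarrow> k > 0 \<Longrightarrow> harm_fps $ k \<noteq> 0"
  using bern_fps_parity_sign[of "k - 1"] by (auto simp: harm_fps_def elim!: evenE)

text \<open>Coefficient comparison in \<open>bern_fps * exp_quot\<close>. This is the linear system
  that makes the increments of the truncated expansion cancel order by order.\<close>

lemma harm_fps_binomial_sum:
  assumes "M > 0"
  shows "(\<Sum>i<M. harm_fps $ Suc i * real (M choose i)) = 1 / real (Suc M)"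
proof -
  obtain L where L: "M = Suc L" using assms by (cases M) auto
  have "(\<Sum>i<M. harm_fps $ Suc i * real (M choose i)) =
        fact M * (\<Sum>i<M. bern_fps $ i * (1 / fact (M - i)))"
    unfolding sum_distrib_left
    by (intro sum.cong) (auto simp: harm_fps_def binomial_fact)
  also have "(\<Sum>i<M. bern_fps $ i * (1 / fact (M - i))) = (bern_fps * exp_quot) $ L"
    unfolding fps_mult_nth L lessThan_Suc_atMost atLeast0AtMost
    by (intro sum.cong) (auto simp: exp_quot_def Suc_diff_le simp del: fact_Suc)
  also have "fact M * \<dots> = 1 / real (Suc M)"
  proof -
    have "fact (L + 2) = real (L + 2) * fact (Suc L)" by simp
    thus ?thesis unfolding bern_fps_mult_exp_quot L by (simp del: fact_Suc)
  qed
  finally show ?thesis .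
qed

section \<open>Asymptotic expansions in inverse powers\<close>

text \<open>Factor out y^p. Convergence at 3/4 gives absolute convergence at 1/2, which bounds the
  remaining series on [0, 1/2].\<close>

lemma power_series_zero_order_bound:
  fixes b :: "nat \<Rightarrow> real"
  assumes sums: "\<And>y. \<bar>y\<bar> < 1 \<Longrightarrow> (\<lambda>i. b i * y ^ i) sums G y"
    and zero: "\<And>i. i < p \<Longrightarrow> b i = 0"
  obtains C where "C \<ge> 0" "\<And>y. 0 \<le> y \<Longrightarrow> y \<le> 1 / 2 \<Longrightarrow> \<bar>G y\<bar> \<le> C * y ^ p"
proof -
  have "summable (\<lambda>i. b i * (3 / 4) ^ i)"
    by (rule sums_summable[OF sums]) simp
  hence "summable (\<lambda>i. norm (b i * (1 / 2) ^ i))"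
    by (rule powser_insidea) auto
  hence "summable (\<lambda>i. 2 ^ p * norm (b (i + p) * (1 / 2) ^ (i + p)))"
    by (intro summable_mult summable_ignore_initial_segment)
  hence S: "summable (\<lambda>i. \<bar>b (i + p)\<bar> * (1 / 2) ^ i)"
    by (simp add: abs_mult power_add power_one_over mult_ac divide_simps)
  show ?thesis
  proof (rule that)
    show "0 \<le> (\<Sum>i. \<bar>b (i + p)\<bar> * (1 / 2) ^ i)"
      using S by (intro suminf_nonneg) auto
  next
    fix y :: real assume y: "0 \<le> y" "y \<le> 1 / 2"
    have le: "norm (b (i + p) * y ^ i) \<le> \<bar>b (i + p)\<bar> * (1 / 2) ^ i" for i
      using y unfolding real_norm_def abs_mult power_abs
      by (intro mult_left_mono power_mono) auto
    have abs: "summable (\<lambda>i. norm (b (i + p) * y ^ i))"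
      by (rule summable_comparison_test'[OF S, of 0]) (use le in auto)
    have "(\<lambda>i. b (i + p) * y ^ (i + p)) sums G y"
      by (rule iffD2[OF sums_zero_iff_shift]) (use sums[of y] y zero in auto)
    hence "(\<lambda>i. y ^ p * (b (i + p) * y ^ i)) sums G y"
      by (simp add: power_add mult_ac)
    hence "G y = (\<Sum>i. y ^ p * (b (i + p) * y ^ i))"
      by (simp add: sums_iff)
    also have "\<dots> = y ^ p * (\<Sum>i. b (i + p) * y ^ i)"
      by (rule suminf_mult[OF summable_norm_cancel[OF abs]])
    finally have "\<bar>G y\<bar> = y ^ p * norm (\<Sum>i. b (i + p) * y ^ i)"
      using y by (simp add: abs_mult)
    also have "\<dots> \<le> y ^ p * (\<Sum>i. \<bar>b (i + p)\<bar> * (1 / 2) ^ i)"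
      using y le S by (intro mult_left_mono norm_suminf_le zero_le_power) auto
    finally show "\<bar>G y\<bar> \<le> (\<Sum>i. \<bar>b (i + p)\<bar> * (1 / 2) ^ i) * y ^ p"
      by (simp add: mult_ac)
  qed
qed

lemma inverse_Suc_power_LIMSEQ:
  assumes "p > 0"
  shows "(\<lambda>n. (1 / real (Suc n)) ^ p) \<longlonglongrightarrow> 0"
proof -
  have "(\<lambda>n. 1 / real (Suc n)) \<longlonglongrightarrow> 0"
    using LIMSEQ_inverse_real_of_nat by (simp add: inverse_eq_divide)
  from tendsto_power[OF this, of p] show ?thesis
    using assms by (simp add: zero_power)
qed

text \<open>With x = 1/(n+1) and y = 1/(n+2) one has x - y = x y, hence y^(p+1) <= x^p - y^p. The
  increments of g are therefore dominated by those of u = C/(n+1)^p, so u + g and u - g decrease to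
  0 and are nonnegative.\<close>

lemma null_seq_diff_bound:
  fixes g :: "nat \<Rightarrow> real"
  assumes lim: "g \<longlonglongrightarrow> 0" and "C \<ge> 0" "p > 0"
    and diff: "\<And>n. \<bar>g (Suc n) - g n\<bar> \<le> C * (1 / real (Suc (Suc n))) ^ Suc p"
  shows "\<bar>g n\<bar> \<le> C * (1 / real (Suc n)) ^ p"
proof -
  define u where "u = (\<lambda>n. C * (1 / real (Suc n)) ^ p)"
  obtain q where q: "p = Suc q" using \<open>p > 0\<close> by (cases p) auto
  have u: "u \<longlonglongrightarrow> 0"
    unfolding u_def using \<open>p > 0\<close>
    by (intro tendsto_mult_right_zero inverse_Suc_power_LIMSEQ)
  have key: "(1 / real (Suc (Suc n))) ^ Suc p \<le> (1 / real (Suc n)) ^ p - (1 / real (Suc (Suc n))) ^ p" for n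
  proof -
    define x where "x = 1 / real (Suc n)"
    define y where "y = 1 / real (Suc (Suc n))"
    have xy: "y \<le> x" "y \<ge> 0" "x - y = x * y"
      by (auto simp: x_def y_def field_simps)
    have "y ^ Suc p = y ^ q * (y * y)" by (simp add: q)
    also have "\<dots> \<le> y ^ q * (x * y)"
      using xy by (intro mult_left_mono mult_right_mono) auto
    also have "\<dots> = y ^ q * x - y ^ p"
      unfolding xy(3)[symmetric] by (simp add: q algebra_simps)
    also have "\<dots> \<le> x ^ q * x - y ^ p"
      using xy by (intro diff_right_mono mult_right_mono power_mono) auto
    finally show ?thesis by (simp add: x_def y_def q mult_ac)
  qed
  have diff': "\<bar>g (Suc n) - g n\<bar> \<le> u n - u (Suc n)" for n
    using mult_left_mono[OF key[of n] \<open>C \<ge> 0\<close>] diff[of n]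
    by (simp add: u_def algebra_simps)
  have "decseq (\<lambda>n. g n + u n)" "decseq (\<lambda>n. u n - g n)"
    unfolding decseq_Suc_iff using diff' by (auto simp: abs_le_iff algebra_simps) (smt (verit) diff')+
  moreover have "(\<lambda>n. g n + u n) \<longlonglongrightarrow> 0" "(\<lambda>n. u n - g n) \<longlonglongrightarrow> 0"
    using tendsto_add[OF lim u] tendsto_diff[OF u lim] by simp_all
  ultimately have "0 \<le> g n + u n" "0 \<le> u n - g n"
    by (auto dest: decseq_ge)
  thus ?thesis by (simp add: u_def)
qed

text \<open>The negative binomial series shifted by k + 1 places. Index 0 is treated separately
  because truncated subtraction would yield \<open>0 choose k\<close>, which is 1 for k = 0.\<close>

lemma geometric_power_sums:
  fixes y :: real
  assumes "\<bar>y\<bar> < 1"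
  shows "(\<lambda>i. (if i = 0 then 0 else real ((i - 1) choose k)) * y ^ i) sums (y / (1 - y)) ^ Suc k"
proof -
  have "(\<lambda>n. (- real (Suc k) gchoose n) * (-y) ^ n) sums (1 + (-y)) powr (- real (Suc k))"
    using assms by (intro gen_binomial_real) auto
  also have "(1 + (-y)) powr (- real (Suc k)) = 1 / (1 - y) ^ Suc k"
    using assms by (simp add: powr_minus powr_realpow inverse_eq_divide del: of_nat_Suc)
  also have "(\<lambda>n. (- real (Suc k) gchoose n) * (-y) ^ n) = (\<lambda>n. real ((n + k) choose k) * y ^ n)"
  proof
    fix n
    have "(- real (Suc k) gchoose n) = (-1) ^ n * (real (k + n) gchoose n)"
      by (subst gbinomial_minus) simp
    also have "real (k + n) gchoose n = real ((k + n) choose n)"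
      by (rule binomial_gbinomial [symmetric])
    also have "(k + n) choose n = (n + k) choose k"
      using binomial_symmetric[of n "k + n"] by (simp add: add.commute)
    finally show "(- real (Suc k) gchoose n) * (-y) ^ n = real ((n + k) choose k) * y ^ n"
      using minus_one_mult_self[of n, where 'a = real]
      by (subst power_minus) (simp add: mult_ac)
  qed
  finally have "(\<lambda>n. y ^ Suc k * (real ((n + k) choose k) * y ^ n)) sums (y ^ Suc k * (1 / (1 - y) ^ Suc k))"
    by (rule sums_mult)
  hence "(\<lambda>n. (if n + Suc k = 0 then 0 else real ((n + Suc k - 1) choose k)) * y ^ (n + Suc k))
           sums ((y / (1 - y)) ^ Suc k)"
    by (simp add: power_add power_divide mult_ac)
  thus ?thesis
    by (subst (asm) sums_zero_iff_shift) (auto simp: binomial_eq_0)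
qed

text \<open>
  With \<open>y = 1/(n + 1)\<close> this is the increment from \<open>n\<close> to \<open>n + 1\<close> of the remainder of the truncated
  expansion of \<open>H\<^sub>n - ln n\<close>, since \<open>1/n = y/(1 - y)\<close>.
\<close>

lemma harm_step_order:
  obtains C where "C \<ge> 0"
    "\<And>y::real. 0 \<le> y \<Longrightarrow> y \<le> 1 / 2 \<Longrightarrow>
       \<bar>y + ln (1 - y) - (\<Sum>k<N. harm_fps $ Suc k * (y ^ Suc k - (y / (1 - y)) ^ Suc k))\<bar>
       \<le> C * y ^ (N + 2)"
proof -
  \<comment> \<open>The power series coefficients of the left-hand side; at i = 0 the convention 1/0
    = 0 fits the missing constant term of ln (1 - y).\<close>
  define b where "b = (\<lambda>i. (if i = 1 then 1 else 0) - 1 / real i -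
     (\<Sum>k<N. harm_fps $ Suc k * ((if i = Suc k then 1 else 0) -
        (if i = 0 then 0 else real ((i - 1) choose k)))))"
  define G :: "real \<Rightarrow> real" where
    "G = (\<lambda>y. y + ln (1 - y) - (\<Sum>k<N. harm_fps $ Suc k * (y ^ Suc k - (y / (1 - y)) ^ Suc k)))"
  have sums: "(\<lambda>i. b i * y ^ i) sums G y" if y: "\<bar>y\<bar> < 1" for y
  proof -
    have single: "(\<lambda>i. (if i = j then 1 else 0) * y ^ i) sums y ^ j" for j
    proof -
      have "(\<lambda>i. (if i = j then 1 else 0) * y ^ i) = (\<lambda>i. if i = j then y ^ i else 0)" by auto
      thus ?thesis using sums_single[of j "\<lambda>i. y ^ i"] by simp
    qed
    have ln: "(\<lambda>i. - (1 / real i) * y ^ i) sums ln (1 - y)"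
      using ln_series'[of "-y"] y by simp
    have "(\<lambda>i. (if i = 1 then 1 else 0) * y ^ i + - (1 / real i) * y ^ i -
            (\<Sum>k<N. harm_fps $ Suc k * ((if i = Suc k then 1 else 0) * y ^ i -
               (if i = 0 then 0 else real ((i - 1) choose k)) * y ^ i))) sums
            (y ^ 1 + ln (1 - y) - (\<Sum>k<N. harm_fps $ Suc k * (y ^ Suc k - (y / (1 - y)) ^ Suc k)))"
      by (intro sums_diff sums_add sums_sum sums_mult single ln geometric_power_sums y)
    thus ?thesis
      by (simp add: b_def G_def left_diff_distrib sum_distrib_right mult.assoc)
  qed
  have zero: "b i = 0" if i: "i < N + 2" for i
  proof -
    consider "i = 0" | "i = 1" | M where "i = Suc M" "M > 0" "M \<le> N"
      using i by (cases i; cases "i - 1") auto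
    thus ?thesis
    proof cases
      case 1
      thus ?thesis by (simp add: b_def)
    next
      case 2
      have "(if 1 = Suc k then 1 else 0) - real ((1 - 1) choose k) = 0" for k
        by (cases k) auto
      thus ?thesis using 2 by (simp add: b_def)
    next
      \<comment> \<open>At index M + 1 the term k = M cancels, since \<open>M choose M\<close> is 1,
        and those with k > M vanish; what is left is the sum of
        \<open>harm_fps_binomial_sum\<close>.\<close>
      case (3 M)
      have "(\<Sum>k<N. harm_fps $ Suc k * ((if i = Suc k then 1 else 0) - real ((i - 1) choose k))) =
            (\<Sum>k<M. - (harm_fps $ Suc k * real (M choose k)))"
        using 3 by (intro sum.mono_neutral_cong_right) (auto simp: binomial_eq_0)
      also have "\<dots> = - (1 / real (Suc M))"
        using harm_fps_binomial_sum[OF \<open>M > 0\<close>] by (simp add: sum_negf)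
      finally show ?thesis
        using 3 by (simp add: b_def)
    qed
  qed
  show ?thesis
    using power_series_zero_order_bound[OF sums zero] that unfolding G_def by blast
qed

text \<open>The expansion is in powers of \<open>1/(n + 1)\<close>, in line with the shifted summation index.\<close>

definition inv_expansion :: "(nat \<Rightarrow> real) \<Rightarrow> real fps \<Rightarrow> bool" where
  "inv_expansion f P \<longleftrightarrow> (\<forall>N. \<exists>C\<ge>0. \<forall>n.
     \<bar>f n - (\<Sum>k\<le>N. P $ k * (1 / real (Suc n)) ^ k)\<bar> \<le> C * (1 / real (Suc n)) ^ Suc N)"

lemma inv_expansion_1: "inv_expansion (\<lambda>_. 1) 1"
proof -
  have "(\<Sum>k\<le>N. (1 :: real fps) $ k * (1 / real (Suc n)) ^ k) = 1" for n N
    by (subst sum.atMost_shift) (simp del: of_nat_Suc)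
  thus ?thesis unfolding inv_expansion_def by (intro allI exI[of _ 0]) simp
qed

text \<open>The two sides differ by the pairs i, j <= N with i + j > N; for 0 <= x <= 1 each of them
  is at most a constant times x^(N+1).\<close>

lemma truncated_product_bound:
  fixes P Q :: "real fps"
  obtains C where "C \<ge> 0" "\<And>x. 0 \<le> x \<Longrightarrow> x \<le> 1 \<Longrightarrow>
    \<bar>(\<Sum>k\<le>N. P $ k * x ^ k) * (\<Sum>k\<le>N. Q $ k * x ^ k) - (\<Sum>k\<le>N. (P * Q) $ k * x ^ k)\<bar>
      \<le> C * x ^ Suc N"
proof -
  define U where "U = {..N} \<times> {..N} - {(i, j). i + j \<le> N}"
  define C where "C = (\<Sum>(i, j)\<in>U. \<bar>P $ i * Q $ j\<bar>)"
  show ?thesis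
  proof (rule that)
    show "C \<ge> 0" unfolding C_def by (intro sum_nonneg) auto
  next
    fix x :: real assume x: "0 \<le> x" "x \<le> 1"
    define t where "t = (\<lambda>i j. P $ i * Q $ j * x ^ (i + j))"
    have "(\<Sum>k\<le>N. P $ k * x ^ k) * (\<Sum>k\<le>N. Q $ k * x ^ k) = (\<Sum>(i, j)\<in>{..N} \<times> {..N}. t i j)"
      by (simp add: sum_product sum.cartesian_product t_def power_add mult_ac)
    also have "{..N} \<times> {..N} = U \<union> {(i, j). i + j \<le> N}" by (auto simp: U_def)
    also have "(\<Sum>(i, j)\<in>\<dots>. t i j) = (\<Sum>(i, j)\<in>U. t i j) + (\<Sum>(i, j)\<in>{(i, j). i + j \<le> N}. t i j)"
    proof (rule sum.union_disjoint)
      have "finite ({..N} \<times> {..N})" by simp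
      thus "finite {(i, j). i + j \<le> N}" by (rule finite_subset[rotated]) auto
    qed (auto simp: U_def)
    also have "(\<Sum>(i, j)\<in>{(i, j). i + j \<le> N}. t i j) = (\<Sum>k\<le>N. (P * Q) $ k * x ^ k)"
      unfolding sum.triangle_reindex_eq
      by (intro sum.cong) (auto simp: t_def fps_mult_nth atLeast0AtMost sum_distrib_right)
    finally have "\<bar>(\<Sum>k\<le>N. P $ k * x ^ k) * (\<Sum>k\<le>N. Q $ k * x ^ k) - (\<Sum>k\<le>N. (P * Q) $ k * x ^ k)\<bar> =
         \<bar>\<Sum>(i, j)\<in>U. t i j\<bar>" by simp
    also have "\<dots> \<le> (\<Sum>(i, j)\<in>U. \<bar>t i j\<bar>)"
      by (rule order_trans[OF sum_abs]) (simp add: case_prod_unfold)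
    also have "\<dots> \<le> (\<Sum>(i, j)\<in>U. \<bar>P $ i * Q $ j\<bar> * x ^ Suc N)"
    proof (intro sum_mono, clarify)
      fix i j assume "(i, j) \<in> U"
      hence "x ^ (i + j) \<le> x ^ Suc N"
        using x by (intro power_decreasing) (auto simp: U_def)
      thus "\<bar>t i j\<bar> \<le> \<bar>P $ i * Q $ j\<bar> * x ^ Suc N"
        using x by (auto simp: t_def abs_mult intro!: mult_left_mono)
    qed
    also have "\<dots> = C * x ^ Suc N"
      by (simp add: C_def sum_distrib_right case_prod_unfold)
    finally show "\<bar>(\<Sum>k\<le>N. P $ k * x ^ k) * (\<Sum>k\<le>N. Q $ k * x ^ k) -
        (\<Sum>k\<le>N. (P * Q) $ k * x ^ k)\<bar> \<le> C * x ^ Suc N" .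
  qed
qed

lemma truncation_bounded:
  fixes P :: "real fps"
  assumes "0 \<le> x" "x \<le> 1"
  shows "\<bar>\<Sum>k\<le>N. P $ k * x ^ k\<bar> \<le> (\<Sum>k\<le>N. \<bar>P $ k\<bar>)"
  using assms by (intro order_trans[OF sum_abs] sum_mono)
    (auto simp: abs_mult power_le_one intro!: mult_left_le)

lemma inv_expansion_mult:
  assumes f: "inv_expansion f P" and g: "inv_expansion g Q"
  shows "inv_expansion (\<lambda>n. f n * g n) (P * Q)"
  unfolding inv_expansion_def
proof
  fix N
  define p where "p = (\<lambda>n. \<Sum>k\<le>N. P $ k * (1 / real (Suc n)) ^ k)"
  define q where "q = (\<lambda>n. \<Sum>k\<le>N. Q $ k * (1 / real (Suc n)) ^ k)"
  define x where "x = (\<lambda>n. 1 / real (Suc n))"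
  have x: "0 \<le> x n" "x n \<le> 1" for n by (auto simp: x_def)
  obtain C1 where C1: "C1 \<ge> 0" "\<And>n. \<bar>f n - p n\<bar> \<le> C1 * x n ^ Suc N"
    using f unfolding inv_expansion_def p_def x_def by blast
  obtain C2 where C2: "C2 \<ge> 0" "\<And>n. \<bar>g n - q n\<bar> \<le> C2 * x n ^ Suc N"
    using g unfolding inv_expansion_def q_def x_def by blast
  obtain C3 where C3: "C3 \<ge> 0"
    "\<And>n. \<bar>p n * q n - (\<Sum>k\<le>N. (P * Q) $ k * x n ^ k)\<bar> \<le> C3 * x n ^ Suc N"
  proof -
    obtain C where "C \<ge> 0" and C: "\<And>x. 0 \<le> x \<Longrightarrow> x \<le> 1 \<Longrightarrow>
        \<bar>(\<Sum>k\<le>N. P $ k * x ^ k) * (\<Sum>k\<le>N. Q $ k * x ^ k) - (\<Sum>k\<le>N. (P * Q) $ k * x ^ k)\<bar>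
          \<le> C * x ^ Suc N"
      using truncated_product_bound[where N = N and P = P and Q = Q] by blast
    show ?thesis
      by (rule that[OF \<open>C \<ge> 0\<close>]) (use C[OF x] in \<open>simp only: p_def q_def x_def\<close>)
  qed
  define M1 M2 where "M1 = (\<Sum>k\<le>N. \<bar>P $ k\<bar>)" and "M2 = (\<Sum>k\<le>N. \<bar>Q $ k\<bar>)"
  have p: "\<bar>p n\<bar> \<le> M1" and q: "\<bar>q n\<bar> \<le> M2" for n
    unfolding p_def q_def M1_def M2_def using x[of n]
    by (auto intro!: truncation_bounded simp: x_def)
  have "M2 \<ge> 0" "M1 \<ge> 0" by (auto simp: M1_def M2_def intro: sum_nonneg)
  have g': "\<bar>g n\<bar> \<le> C2 + M2" for n
  proof -
    have "C2 * x n ^ Suc N \<le> C2 * 1"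
      using x C2(1) by (intro mult_left_mono power_le_one) auto
    thus ?thesis using C2(2)[of n] q[of n] by linarith
  qed
  show "\<exists>C\<ge>0. \<forall>n. \<bar>f n * g n - (\<Sum>k\<le>N. (P * Q) $ k * (1 / real (Suc n)) ^ k)\<bar>
              \<le> C * (1 / real (Suc n)) ^ Suc N"
  proof (intro exI[of _ "C1 * (C2 + M2) + M1 * C2 + C3"] conjI allI)
    show "0 \<le> C1 * (C2 + M2) + M1 * C2 + C3"
      using C1 C2 C3 \<open>M1 \<ge> 0\<close> \<open>M2 \<ge> 0\<close> by simp
  next
    fix n
    have "f n * g n - (\<Sum>k\<le>N. (P * Q) $ k * x n ^ k) =
          (f n - p n) * g n + p n * (g n - q n) + (p n * q n - (\<Sum>k\<le>N. (P * Q) $ k * x n ^ k))"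
      by (simp add: algebra_simps)
    also have "\<bar>\<dots>\<bar> \<le> \<bar>f n - p n\<bar> * \<bar>g n\<bar> + \<bar>p n\<bar> * \<bar>g n - q n\<bar> +
        \<bar>p n * q n - (\<Sum>k\<le>N. (P * Q) $ k * x n ^ k)\<bar>"
      unfolding abs_mult [symmetric] by linarith
    also have "\<dots> \<le> (C1 * x n ^ Suc N) * (C2 + M2) + M1 * (C2 * x n ^ Suc N) + C3 * x n ^ Suc N"
      using C1 C2 C3 p g' x \<open>M1 \<ge> 0\<close> by (intro add_mono mult_mono) auto
    also have "\<dots> = (C1 * (C2 + M2) + M1 * C2 + C3) * x n ^ Suc N"
      by (simp add: algebra_simps)
    finally show "\<bar>f n * g n - (\<Sum>k\<le>N. (P * Q) $ k * (1 / real (Suc n)) ^ k)\<bar>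
       \<le> (C1 * (C2 + M2) + M1 * C2 + C3) * (1 / real (Suc n)) ^ Suc N"
      by (simp only: x_def)
  qed
qed

lemma inv_expansion_power: "inv_expansion f P \<Longrightarrow> inv_expansion (\<lambda>n. f n ^ m) (P ^ m)"
  by (induction m) (auto intro: inv_expansion_1 inv_expansion_mult)

text \<open>The remainder tends to 0 by the definition of Euler's constant, and its increments have
  order N + 2; summing them from infinity costs one order.\<close>

lemma inv_expansion_harm: "inv_expansion (\<lambda>n. harm (Suc n) - ln (real (Suc n))) harm_fps"
  unfolding inv_expansion_def
proof
  fix N
  define g :: "nat \<Rightarrow> real" where
    "g = (\<lambda>n. harm (Suc n) - ln (real (Suc n)) - (\<Sum>k\<le>N. harm_fps $ k * (1 / real (Suc n)) ^ k))"
  obtain C where C: "C \<ge> 0" "\<And>y::real. 0 \<le> y \<Longrightarrow> y \<le> 1 / 2 \<Longrightarrow>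
       \<bar>y + ln (1 - y) - (\<Sum>k<N. harm_fps $ Suc k * (y ^ Suc k - (y / (1 - y)) ^ Suc k))\<bar>
       \<le> C * y ^ (N + 2)"
    using harm_step_order[where N = N] by blast
  have g_eq: "g n = harm (Suc n) - ln (real (Suc n)) - euler_mascheroni -
                (\<Sum>k<N. harm_fps $ Suc k * (1 / real (Suc n)) ^ Suc k)" for n
    unfolding g_def by (subst sum.atMost_shift) (simp add: harm_fps_def)
  have lim: "g \<longlonglongrightarrow> 0"
  proof -
    have 1: "(\<lambda>n. \<Sum>k<N. harm_fps $ Suc k * (1 / real (Suc n)) ^ Suc k) \<longlonglongrightarrow> 0"
      by (intro tendsto_null_sum tendsto_mult_right_zero inverse_Suc_power_LIMSEQ) simp
    have "(\<lambda>n. harm (Suc n) - ln (real (Suc n))) \<longlonglongrightarrow> (euler_mascheroni :: real)"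
      using euler_mascheroni_LIMSEQ by (rule LIMSEQ_Suc)
    from tendsto_diff[OF tendsto_diff[OF this tendsto_const[of euler_mascheroni]] 1]
    show ?thesis unfolding g_eq[abs_def] by simp
  qed
  have "\<bar>g n\<bar> \<le> C * (1 / real (Suc n)) ^ Suc N" for n
  proof (rule null_seq_diff_bound[OF lim C(1)])
    fix n
    define y where "y = 1 / real (Suc (Suc n))"
    have y: "0 \<le> y" "y \<le> 1 / 2" by (auto simp: y_def field_simps)
    have y1: "1 / real (Suc n) = y / (1 - y)" by (simp add: y_def field_simps)
    have "1 - y = real (Suc n) / real (Suc (Suc n))" by (simp add: y_def field_simps)
    hence ln: "ln (1 - y) = ln (real (Suc n)) - ln (real (Suc (Suc n)))"
      by (simp add: ln_div)
    have "g (Suc n) - g n = y + ln (1 - y) -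
        ((\<Sum>k<N. harm_fps $ Suc k * y ^ Suc k) - (\<Sum>k<N. harm_fps $ Suc k * (y / (1 - y)) ^ Suc k))"
      unfolding g_eq ln y1 y_def[symmetric] harm_Suc[of "Suc n"]
      by (simp add: y_def inverse_eq_divide del: of_nat_Suc)
    also have "\<dots> = y + ln (1 - y) - (\<Sum>k<N. harm_fps $ Suc k * (y ^ Suc k - (y / (1 - y)) ^ Suc k))"
      by (simp add: right_diff_distrib sum_subtractf)
    finally show "\<bar>g (Suc n) - g n\<bar> \<le> C * (1 / real (Suc (Suc n))) ^ Suc (Suc N)"
      using C(2)[OF y] by (simp add: y_def)
  qed auto
  thus "\<exists>C\<ge>0. \<forall>n. \<bar>harm (Suc n) - ln (real (Suc n)) - (\<Sum>k\<le>N. harm_fps $ k * (1 / real (Suc n)) ^ k)\<bar>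
           \<le> C * (1 / real (Suc n)) ^ Suc N"
    using C(1) unfolding g_def by blast
qed

section \<open>Dirichlet series with powers of logarithms\<close>

lemma ln_power_bigo:
  assumes "e > 0"
  shows "(\<lambda>n. ln (real (Suc n)) ^ j) \<in> O(\<lambda>n. real (Suc n) powr e)"
proof (rule bigoI[of _ "(1 / (e / real (Suc j))) ^ j"], intro always_eventually allI)
  fix n
  \<comment> \<open>Dividing by j + 1 keeps d well defined for j = 0 and still gives d j <=
    e.\<close>
  define d where "d = e / real (Suc j)"
  have d: "d > 0" "d * real j \<le> e" using assms by (auto simp: d_def field_simps)
  have "ln (real (Suc n)) ^ j \<le> (real (Suc n) powr d / d) ^ j"
    using d by (intro power_mono ln_powr_bound) auto
  also have "\<dots> = (1 / d) ^ j * real (Suc n) powr (d * real j)"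
    by (simp add: power_divide powr_powr [symmetric] powr_realpow del: of_nat_Suc)
  also have "\<dots> \<le> (1 / d) ^ j * real (Suc n) powr e"
    using d by (intro mult_left_mono powr_mono) auto
  finally show "norm (ln (real (Suc n)) ^ j) \<le> (1 / d) ^ j * norm (real (Suc n) powr e)"
    by simp
qed

lemma ln_power_dser:
  assumes "Re s > 1"
  shows "(\<lambda>n. of_real (ln (real (Suc n)) ^ j) * of_nat (Suc n) powr - s) sums
           dser (\<lambda>n. ln (real (Suc n)) ^ j) s"
    and "(dser (\<lambda>n. ln (real (Suc n)) ^ j) has_field_derivative
           - dser (\<lambda>n. ln (real (Suc n)) ^ Suc j) s) (at s)"
proof -
  \<comment> \<open>Half of the distance of Re s from 1 is spent on absorbing the
    logarithms.\<close>
  have *: "(\<lambda>n. ln (real (Suc n)) ^ j) \<in> O(\<lambda>n. real (Suc n) powr ((Re s - 1) / 2))"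
    using assms by (intro ln_power_bigo) auto
  have **: "(Re s - 1) / 2 + 1 < Re s" using assms by (simp add: field_simps)
  note dser_properties[OF * **]
  thus "(\<lambda>n. of_real (ln (real (Suc n)) ^ j) * of_nat (Suc n) powr - s) sums
           dser (\<lambda>n. ln (real (Suc n)) ^ j) s"
    and "(dser (\<lambda>n. ln (real (Suc n)) ^ j) has_field_derivative
           - dser (\<lambda>n. ln (real (Suc n)) ^ Suc j) s) (at s)"
    unfolding power_Suc2 .
qed

text \<open>Induction by differentiation: -d/ds multiplies the coefficients by ln (n + 1), turns
  j!/(s-1)^(j+1) into (j+1)!/(s-1)^(j+2), and keeps the regular part entire.\<close>

lemma ln_power_dser_continuation:
  "\<exists>L. L holomorphic_on UNIV \<and> (\<forall>s. Re s > 1 \<longrightarrow>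
     dser (\<lambda>n. ln (real (Suc n)) ^ j) s = fact j / (s - 1) ^ Suc j + L s)"
proof (induction j)
  case 0
  obtain Z where "Z holomorphic_on UNIV"
    "\<And>s. Re s > 1 \<Longrightarrow> zeta_series s = 1 / (s - 1) + Z s"
    by (rule zeta_series_continuation) blast
  thus ?case by (intro exI[of _ Z]) (simp add: zeta_series_def)
next
  case (Suc j)
  then obtain L where L: "L holomorphic_on UNIV"
    "\<And>s. Re s > 1 \<Longrightarrow> dser (\<lambda>n. ln (real (Suc n)) ^ j) s = fact j / (s - 1) ^ Suc j + L s"
    by blast
  have "dser (\<lambda>n. ln (real (Suc n)) ^ Suc j) s = fact (Suc j) / (s - 1) ^ Suc (Suc j) + - deriv L s"
    if s: "Re s > 1" for s
  proof -
    have "s \<noteq> 1" using s by auto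
    have "((\<lambda>s. fact j * inverse (s - 1) ^ Suc j) has_field_derivative
            fact j * ((1 + of_nat j) * ((- (inverse (s - 1) * 1 * inverse (s - 1))) * inverse (s - 1) ^ j))) (at s)"
      using \<open>s \<noteq> 1\<close> by (intro DERIV_cmult DERIV_power_Suc DERIV_inverse')
        (auto intro!: derivative_eq_intros)
    moreover have "(L has_field_derivative deriv L s) (at s)"
      using holomorphic_derivI[OF L(1)] by simp
    ultimately have "((\<lambda>s. fact j * inverse (s - 1) ^ Suc j + L s) has_field_derivative
            fact j * ((1 + of_nat j) * ((- (inverse (s - 1) * 1 * inverse (s - 1))) * inverse (s - 1) ^ j))
            + deriv L s) (at s)"
      by (rule DERIV_add)
    hence "(dser (\<lambda>n. ln (real (Suc n)) ^ j) has_field_derivative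
            fact j * ((1 + of_nat j) * ((- (inverse (s - 1) * 1 * inverse (s - 1))) * inverse (s - 1) ^ j))
            + deriv L s) (at s)"
      by (rule has_field_derivative_transform_within_open[OF _ open_halfplane[of 1]])
         (use s L(2) in \<open>auto simp: divide_inverse power_inverse\<close>)
    from DERIV_unique[OF this ln_power_dser(2)[OF s]]
    have "dser (\<lambda>n. ln (real (Suc n)) ^ Suc j) s =
       fact j * ((1 + of_nat j) * (inverse (s - 1) * inverse (s - 1) * inverse (s - 1) ^ j)) - deriv L s"
      by (simp add: algebra_simps)
    thus ?thesis by (simp add: divide_inverse power_inverse mult_ac del: of_nat_add)
  qed
  moreover have "(\<lambda>s. - deriv L s) holomorphic_on UNIV"
    by (intro holomorphic_intros holomorphic_deriv L(1)) auto
  ultimately show ?case by blast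
qed

section \<open>Decomposition of the Dirichlet series\<close>

text \<open>The coefficient of (ln n)^j n^(-k) in the expansion of (ln n + A_n)^m, where A_n = H_n -
  ln n.\<close>

definition harm_coeff :: "nat \<Rightarrow> nat \<Rightarrow> nat \<Rightarrow> real" where
  "harm_coeff m j k = real (m choose j) * (harm_fps ^ (m - j)) $ k"

text \<open>Truncating the powers of A_n leaves errors of order n^(-K-1); one power of n is given up
  to absorb the logarithms.\<close>

lemma harm_power_remainder:
  "(\<lambda>n. harm (Suc n) ^ m -
      (\<Sum>j\<le>m. \<Sum>k\<le>K. harm_coeff m j k * ln (real (Suc n)) ^ j * (1 / real (Suc n)) ^ k))
     \<in> O(\<lambda>n. real (Suc n) powr - real K)"
proof -
  define A :: "nat \<Rightarrow> real" where "A = (\<lambda>n. harm (Suc n) - ln (real (Suc n)))"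
  define T where "T = (\<lambda>j n. A n ^ (m - j) - (\<Sum>k\<le>K. (harm_fps ^ (m - j)) $ k * (1 / real (Suc n)) ^ k))"
  have T: "T j \<in> O(\<lambda>n. real (Suc n) powr (- real K - 1))" for j
  proof -
    have "inv_expansion (\<lambda>n. A n ^ (m - j)) (harm_fps ^ (m - j))"
      unfolding A_def by (intro inv_expansion_power inv_expansion_harm)
    then obtain C where C: "\<And>n. \<bar>T j n\<bar> \<le> C * (1 / real (Suc n)) ^ Suc K"
      unfolding inv_expansion_def T_def by blast
    have "(1 / real (Suc n)) ^ Suc K = real (Suc n) powr (- real K - 1)" for n
    proof -
      have "real (Suc n) powr (- real (Suc K)) = (1 / real (Suc n)) ^ Suc K"
        by (simp only: powr_minus powr_realpow of_nat_0_less_iff zero_less_Suc inverse_eq_divide power_one_over)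
      moreover have "- real (Suc K) = - real K - 1" by simp
      ultimately show ?thesis by (simp only:)
    qed
    with C have "\<bar>T j n\<bar> \<le> C * real (Suc n) powr (- real K - 1)" for n by metis
    thus ?thesis by (intro bigoI[of _ C] always_eventually allI) simp
  qed
  have "(\<lambda>n. real (m choose j) * (ln (real (Suc n)) ^ j * T j n)) \<in> O(\<lambda>n. real (Suc n) powr - real K)" for j
  proof -
    have "(\<lambda>n. ln (real (Suc n)) ^ j * T j n) \<in>
            O(\<lambda>n. real (Suc n) powr 1 * real (Suc n) powr (- real K - 1))"
      by (intro landau_o.big.mult ln_power_bigo T) auto
    also have "(\<lambda>n. real (Suc n) powr 1 * real (Suc n) powr (- real K - 1)) = (\<lambda>n. real (Suc n) powr - real K)"
      by (simp only: powr_add [symmetric]) simp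
    finally show ?thesis by simp
  qed
  hence "(\<lambda>n. \<Sum>j\<le>m. real (m choose j) * (ln (real (Suc n)) ^ j * T j n)) \<in> O(\<lambda>n. real (Suc n) powr - real K)"
    by (intro big_sum_in_bigo)
  also have "(\<lambda>n. \<Sum>j\<le>m. real (m choose j) * (ln (real (Suc n)) ^ j * T j n)) =
     (\<lambda>n. harm (Suc n) ^ m -
      (\<Sum>j\<le>m. \<Sum>k\<le>K. harm_coeff m j k * ln (real (Suc n)) ^ j * (1 / real (Suc n)) ^ k))"
  proof
    fix n
    have "harm (Suc n) ^ m = (ln (real (Suc n)) + A n) ^ m" by (simp add: A_def)
    also have "\<dots> = (\<Sum>j\<le>m. real (m choose j) * ln (real (Suc n)) ^ j * A n ^ (m - j))"
      by (rule binomial_ring)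
    finally show "(\<Sum>j\<le>m. real (m choose j) * (ln (real (Suc n)) ^ j * T j n)) = harm (Suc n) ^ m -
      (\<Sum>j\<le>m. \<Sum>k\<le>K. harm_coeff m j k * ln (real (Suc n)) ^ j * (1 / real (Suc n)) ^ k)"
      by (simp add: T_def harm_coeff_def sum_subtractf right_diff_distrib sum_distrib_left mult_ac
               del: of_nat_Suc)
  qed
  finally show ?thesis .
qed

text \<open>The principal part at 1 - k, collected from the series of (ln n)^j n^(-z-k). At 1 - k
  itself its value is 0, by the convention for division by zero.\<close>

definition polar_part :: "nat \<Rightarrow> nat \<Rightarrow> complex \<Rightarrow> complex" where
  "polar_part m k z = (\<Sum>j\<le>m. of_real (harm_coeff m j k) * fact j / (z - (1 - of_nat k)) ^ Suc j)"

lemma harm_dirichlet_decomposition: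
  obtains G where "G holomorphic_on {z. 1 - real K < Re z}"
    and "\<And>z. Re z > 1 \<Longrightarrow> harm_dirichlet_term m z sums ((\<Sum>k\<le>K. polar_part m k z) + G z)"
proof -
  obtain L where L: "\<And>j. L j holomorphic_on UNIV"
    "\<And>j s. Re s > 1 \<Longrightarrow> dser (\<lambda>n. ln (real (Suc n)) ^ j) s = fact j / (s - 1) ^ Suc j + L j s"
    using ln_power_dser_continuation by metis
  define r where "r = (\<lambda>n. harm (Suc n) ^ m -
      (\<Sum>j\<le>m. \<Sum>k\<le>K. harm_coeff m j k * ln (real (Suc n)) ^ j * (1 / real (Suc n)) ^ k))"
  have r: "r \<in> O(\<lambda>n. real (Suc n) powr - real K)"
    unfolding r_def by (rule harm_power_remainder)
  define G where "G = (\<lambda>z. dser r z + (\<Sum>k\<le>K. \<Sum>j\<le>m. of_real (harm_coeff m j k) * L j (z + of_nat k)))"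
  have "(\<lambda>z. L j (z + of_nat k)) holomorphic_on A" for j k A
    by (rule holomorphic_on_compose_gen[OF _ L(1), unfolded o_def]) (auto intro!: holomorphic_intros)
  moreover have "dser r holomorphic_on {z. 1 - real K < Re z}"
    using holomorphic_on_dser[OF r] by (simp add: add.commute)
  ultimately have G: "G holomorphic_on {z. 1 - real K < Re z}"
    unfolding G_def by (intro holomorphic_intros)
  have "harm_dirichlet_term m z sums ((\<Sum>k\<le>K. polar_part m k z) + G z)" if z: "Re z > 1" for z
  proof -
    have 1: "(\<lambda>n. of_real (r n) * of_nat (Suc n) powr - z) sums dser r z"
      by (rule dser_properties(1)[OF r]) (use z in simp)
    have 2: "(\<lambda>n. of_real (ln (real (Suc n)) ^ j) * of_nat (Suc n) powr - (z + of_nat k)) sums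
             (fact j / (z - (1 - of_nat k)) ^ Suc j + L j (z + of_nat k))" for j k
      using ln_power_dser(1)[of "z + of_nat k" j] L(2)[of "z + of_nat k" j] z
      by (simp add: algebra_simps)
    have "(\<lambda>n. of_real (r n) * of_nat (Suc n) powr - z +
            (\<Sum>k\<le>K. \<Sum>j\<le>m. of_real (harm_coeff m j k) *
               (of_real (ln (real (Suc n)) ^ j) * of_nat (Suc n) powr - (z + of_nat k)))) sums
          (dser r z + (\<Sum>k\<le>K. \<Sum>j\<le>m. of_real (harm_coeff m j k) *
             (fact j / (z - (1 - of_nat k)) ^ Suc j + L j (z + of_nat k))))"
      by (intro sums_add 1 sums_sum sums_mult 2)
    also have "(\<lambda>n. of_real (r n) * of_nat (Suc n) powr - z +
            (\<Sum>k\<le>K. \<Sum>j\<le>m. of_real (harm_coeff m j k) *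
               (of_real (ln (real (Suc n)) ^ j) * of_nat (Suc n) powr - (z + of_nat k)))) =
            harm_dirichlet_term m z"
    proof
      fix n
      define N :: complex where "N = of_nat (Suc n)"
      have "N \<noteq> 0" unfolding N_def by (simp del: of_nat_Suc)
      \<comment> \<open>The factor n^(-k) is a shift of the argument by k, so each term of the
        expansion becomes a logarithmic series at z + k.\<close>
      hence N_powr: "N powr - (z + of_nat k) = of_real ((1 / real (Suc n)) ^ k) * N powr - z" for k
        by (simp add: powr_diff powr_nat N_def power_one_over power_inverse divide_inverse mult_ac del: of_nat_Suc)
      define q where
        "q = (\<Sum>j\<le>m. \<Sum>k\<le>K. harm_coeff m j k * ln (real (Suc n)) ^ j * (1 / real (Suc n)) ^ k)"
      have "(\<Sum>k\<le>K. \<Sum>j\<le>m. of_real (harm_coeff m j k) *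
               (of_real (ln (real (Suc n)) ^ j) * N powr - (z + of_nat k))) =
            of_real q * N powr - z"
        unfolding N_powr q_def of_real_sum sum_distrib_right
        by (subst sum.swap) (simp add: mult_ac del: of_nat_Suc)
      moreover have "harm (Suc n) ^ m = r n + q"
        by (simp add: r_def q_def)
      hence "(of_real (harm (Suc n) ^ m) :: complex) = of_real (r n + q)" by (rule arg_cong)
      hence "(harm (Suc n) :: complex) ^ m = of_real (r n) + of_real q"
        by (simp only: of_real_harm of_real_power of_real_add)
      ultimately show "of_real (r n) * of_nat (Suc n) powr - z +
            (\<Sum>k\<le>K. \<Sum>j\<le>m. of_real (harm_coeff m j k) *
               (of_real (ln (real (Suc n)) ^ j) * of_nat (Suc n) powr - (z + of_nat k))) =
            harm_dirichlet_term m z n"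
        unfolding N_def [symmetric] harm_dirichlet_term_def by (simp only: distrib_right)
    qed
    also have "dser r z + (\<Sum>k\<le>K. \<Sum>j\<le>m. of_real (harm_coeff m j k) *
             (fact j / (z - (1 - of_nat k)) ^ Suc j + L j (z + of_nat k))) =
          (\<Sum>k\<le>K. polar_part m k z) + G z"
      by (simp add: polar_part_def G_def distrib_left sum.distrib)
    finally show ?thesis .
  qed
  with G show ?thesis by (rule that)
qed

section \<open>Orders of the poles\<close>

text \<open>Multiplying by (z - z0)^(J+1) yields a holomorphic h with h(z0) = b_J, which is
  nonzero.\<close>

lemma is_pole_zorder_polar_part:
  fixes f g :: "complex \<Rightarrow> complex"
  assumes g: "g analytic_on {z0}"
    and f: "\<forall>\<^sub>F z in at z0. f z = (\<Sum>j\<le>m. b j / (z - z0) ^ Suc j) + g z"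
    and J: "J \<le> m" "b J \<noteq> 0" "\<And>j. J < j \<Longrightarrow> j \<le> m \<Longrightarrow> b j = 0"
  shows "is_pole f z0 \<and> zorder f z0 = - int (Suc J)"
proof -
  obtain e where e: "e > 0" "g holomorphic_on ball z0 e"
    using g by (auto simp: analytic_on_def)
  define h where "h = (\<lambda>z. (\<Sum>j\<le>J. b j * (z - z0) ^ (J - j)) + g z * (z - z0) ^ Suc J)"
  have h: "h holomorphic_on ball z0 e"
    unfolding h_def by (intro holomorphic_intros e(2))
  \<comment> \<open>Only j = J survives, because 0^0 = 1.\<close>
  have "(\<Sum>j\<le>J. b j * (z0 - z0) ^ (J - j)) = (\<Sum>j\<in>{J}. b j)"
    by (intro sum.mono_neutral_cong_right) auto
  hence h0: "h z0 \<noteq> 0" using J(2) by (simp add: h_def)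
  have eq: "(\<Sum>j\<le>m. b j / (z - z0) ^ Suc j) + g z = h z / (z - z0) ^ Suc J" if "z \<noteq> z0" for z
  proof -
    have "(\<Sum>j\<le>m. b j / (z - z0) ^ Suc j) = (\<Sum>j\<le>J. b j / (z - z0) ^ Suc j)"
      using J by (intro sum.mono_neutral_right) auto
    also have "\<dots> = (\<Sum>j\<le>J. b j * (z - z0) ^ (J - j) / (z - z0) ^ Suc J)"
    proof (intro sum.cong refl)
      fix j assume "j \<in> {..J}"
      hence "(z - z0) ^ Suc J = (z - z0) ^ Suc j * (z - z0) ^ (J - j)"
        by (simp flip: power_add)
      thus "b j / (z - z0) ^ Suc j = b j * (z - z0) ^ (J - j) / (z - z0) ^ Suc J"
        using that by (simp only:) simp
    qed
    finally show ?thesis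
      using that by (simp add: h_def add_divide_distrib sum_divide_distrib)
  qed
  have f': "\<forall>\<^sub>F z in at z0. f z = h z / (z - z0) ^ Suc J"
    using f eventually_neq_at_within[of z0 z0] by eventually_elim (simp only: eq not_False_eq_True)
  have "is_pole (\<lambda>z. h z / (z - z0) ^ Suc J) z0"
    by (rule is_pole_basic[OF h _ _ h0]) (use e in auto)
  moreover have "zorder (\<lambda>z. h z / (z - z0) ^ Suc J) z0 = - int (Suc J)"
    by (rule zorder_eqI[OF _ _ h h0])
       (use e in \<open>auto simp: power_int_minus divide_inverse simp del: power_Suc of_nat_Suc\<close>)
  ultimately show ?thesis
    using is_pole_cong[OF f' refl] zorder_cong[OF f' refl] by simp
qed

lemma harm_coeff_top: "harm_coeff m m 0 = 1" "k > 0 \<Longrightarrow> harm_coeff m m k = 0"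
  by (simp_all add: harm_coeff_def)

lemma harm_coeff_second: "m \<ge> 1 \<Longrightarrow> harm_coeff m (m - 1) k = real m * harm_fps $ k"
  using binomial_symmetric[of 1 m] by (simp add: harm_coeff_def)

text \<open>In the square of \<open>harm_fps\<close>, two indices with odd sum k include an odd one,
  which must be 1 to contribute. The two resulting terms give 2 (1/2) a_(k-1), and a_(k-1) is
  nonzero as k - 1 is even and positive.\<close>

lemma harm_coeff_third_nonzero:
  assumes "m \<ge> 2" "odd k" "k > 1"
  shows "harm_coeff m (m - 2) k \<noteq> 0"
proof -
  have "(harm_fps ^ 2) $ k = (\<Sum>i\<le>k. harm_fps $ i * harm_fps $ (k - i))"
    by (simp add: power2_eq_square fps_mult_nth atLeast0AtMost)
  also have "\<dots> = (\<Sum>i\<in>{1, k - 1}. harm_fps $ i * harm_fps $ (k - i))"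
  proof (rule sum.mono_neutral_right)
    show "\<forall>i\<in>{..k} - {1, k - 1}. harm_fps $ i * harm_fps $ (k - i) = 0"
    proof
      fix i assume i: "i \<in> {..k} - {1, k - 1}"
      show "harm_fps $ i * harm_fps $ (k - i) = 0"
      proof (cases "odd i")
        case True
        thus ?thesis using i harm_fps_odd[of i] by simp
      next
        case False
        hence "odd (k - i)" "k - i \<noteq> 1" using i assms by auto
        thus ?thesis using harm_fps_odd[of "k - i"] by simp
      qed
    qed
  qed (use assms in auto)
  also have "\<dots> = harm_fps $ (k - 1)"
  proof -
    have "k \<noteq> 2" using assms by auto
    hence "k - 1 \<noteq> 1" using assms by simp
    thus ?thesis using assms harm_fps_1 by simp
  qed
  also have "\<dots> \<noteq> 0" using assms by (intro harm_fps_even) auto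
  finally show ?thesis
    using assms by (simp add: harm_coeff_def)
qed

section \<open>From the decompositions to one global meromorphic function\<close>

lemma polar_part_analytic:
  assumes "1 - of_nat k \<notin> A"
  shows "polar_part m k analytic_on A"
  unfolding polar_part_def[abs_def] using assms by (intro analytic_intros) auto

lemma polar_part_meromorphic: "polar_part m k meromorphic_on A"
  unfolding polar_part_def[abs_def] by (intro meromorphic_intros)

text \<open>The local form is stated with \<open>nhds\<close>, so it also fixes the value at z0; the
  case of pole order 0 relies on this.\<close>

lemma harm_dirichlet_continuation:
  obtains F where "\<And>z. Re z > 1 \<Longrightarrow> F z = harm_dirichlet m z"
    and "\<And>z0. \<exists>N g. Re z0 > - real N \<and> g analytic_on {z0} \<and>
           (\<forall>\<^sub>F z in nhds z0. F z = (\<Sum>k\<le>Suc N. polar_part m k z) + g z)"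
proof -
  have "\<exists>G. G holomorphic_on {z. 1 - real K < Re z} \<and>
     (\<forall>z. Re z > 1 \<longrightarrow> harm_dirichlet_term m z sums ((\<Sum>k\<le>K. polar_part m k z) + G z))" for K
    using harm_dirichlet_decomposition[of K m] by metis
  then obtain G where G: "\<And>K. G K holomorphic_on {z. 1 - real K < Re z}"
     "\<And>K z. Re z > 1 \<Longrightarrow> harm_dirichlet_term m z sums ((\<Sum>k\<le>K. polar_part m k z) + G K z)"
    by metis
  define f where "f = (\<lambda>n z. (\<Sum>k\<le>Suc n. polar_part m k z) + G (Suc n) z)"
  have f_eq: "f n z = harm_dirichlet m z" if "Re z > 1" for n z
    using G(2)[OF that, of "Suc n"] by (simp add: harm_dirichlet_def f_def sums_iff)
  have G': "G (Suc n) holomorphic_on {z. - real n < Re z}" for n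
    using G(1)[of "Suc n"] by simp
  \<comment> \<open>The common polar parts cancel; the one new pole, at -(n + 1), lies outside the
    half-plane.\<close>
  have hol: "(\<lambda>z. f (Suc n) z - f n z) holomorphic_on {z. - real n < Re z}" for n
  proof -
    have "polar_part m (Suc (Suc n)) holomorphic_on {z. - real n < Re z}"
      by (intro analytic_imp_holomorphic polar_part_analytic) auto
    hence "(\<lambda>z. polar_part m (Suc (Suc n)) z + (G (Suc (Suc n)) z - G (Suc n) z))
             holomorphic_on {z. - real n < Re z}"
      by (intro holomorphic_intros G' holomorphic_on_subset[OF G'[of "Suc n"]]) auto
    thus ?thesis by (simp add: f_def algebra_simps)
  qed
  have eq0: "f n z = f 0 z" if "Re z > 1" for n z
    using f_eq[OF that] by metis
  obtain F where F: "\<And>n z. Re z > - real n \<Longrightarrow> F z = f n z"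
    using halfplane_glue[of f, OF hol eq0] by blast
  show ?thesis
  proof (rule that[of F])
    show "F z = harm_dirichlet m z" if "Re z > 1" for z
      using F[of 0 z] f_eq[OF that] that by simp
  next
    fix z0 :: complex
    obtain N :: nat where N: "Re z0 > - real N"
      using reals_Archimedean2[of "- Re z0"] by (auto simp: minus_less_iff)
    have "G (Suc N) analytic_on {z0}"
      using G'[of N] N open_halfplane[of "- real N"] by (auto simp: analytic_at)
    moreover have "\<forall>\<^sub>F z in nhds z0. z \<in> {z. - real N < Re z}"
      using N by (intro eventually_nhds_in_open open_halfplane) auto
    hence "\<forall>\<^sub>F z in nhds z0. F z = (\<Sum>k\<le>Suc N. polar_part m k z) + G (Suc N) z"
      by eventually_elim (simp add: F[of N] f_def)
    ultimately show "\<exists>N g. Re z0 > - real N \<and> g analytic_on {z0} \<and>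
           (\<forall>\<^sub>F z in nhds z0. F z = (\<Sum>k\<le>Suc N. polar_part m k z) + g z)"
      using N by blast
  qed
qed

text \<open>All other polar parts are analytic at 1 - k and join the regular part.\<close>

lemma polar_part_isolated:
  assumes F: "\<And>z0. \<exists>N g. Re z0 > - real N \<and> g analytic_on {z0} \<and>
           (\<forall>\<^sub>F z in nhds z0. F z = (\<Sum>k\<le>Suc N. polar_part m k z) + g z)"
  obtains g where "g analytic_on {1 - of_nat k}"
    and "\<forall>\<^sub>F z in nhds (1 - of_nat k). F z = polar_part m k z + g z"
proof -
  obtain N g where N: "Re (1 - of_nat k) > - real N" "g analytic_on {1 - of_nat k}"
    "\<forall>\<^sub>F z in nhds (1 - of_nat k). F z = (\<Sum>k\<le>Suc N. polar_part m k z) + g z"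
    using F by blast
  have k: "k \<in> {..Suc N}" using N(1) by simp
  show ?thesis
  proof (rule that)
    show "(\<lambda>z. (\<Sum>k\<in>{..Suc N} - {k}. polar_part m k z) + g z) analytic_on {1 - of_nat k}"
      by (intro analytic_intros N(2) polar_part_analytic) auto
    show "\<forall>\<^sub>F z in nhds (1 - of_nat k). F z = polar_part m k z +
            ((\<Sum>k\<in>{..Suc N} - {k}. polar_part m k z) + g z)"
      using N(3)
    proof eventually_elim
      case (elim z)
      thus ?case using sum.remove[OF _ k, of "\<lambda>k. polar_part m k z"] by simp
    qed
  qed
qed

theorem theorem3:
  fixes m :: nat
  assumes "m \<ge> 1"
  shows "(\<forall>z. Re z > 1 \<longrightarrow> summable (harm_dirichlet_term m z)) \<and>
    (\<exists>F :: complex \<Rightarrow> complex.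
       F meromorphic_on UNIV \<and>
       (\<forall>z. Re z > 1 \<longrightarrow> F z = harm_dirichlet m z) \<and>
       F analytic_on (- insert 1 (range (\<lambda>k::nat. - of_nat k))) \<and>
       has_pole_of_order F 1 (m + 1) \<and>
       has_pole_of_order F 0 m \<and>
       (\<forall>k::nat. odd k \<longrightarrow> has_pole_of_order F (- of_nat k) m) \<and>
       (\<forall>k::nat. even k \<and> k > 0 \<longrightarrow> has_pole_of_order F (- of_nat k) (m - 1)))"
proof (intro conjI allI impI)
  fix z :: complex assume z: "Re z > 1"
  obtain G where "\<And>z. Re z > 1 \<Longrightarrow>
      harm_dirichlet_term m z sums ((\<Sum>k\<le>0. polar_part m k z) + G z)"
    using harm_dirichlet_decomposition[of 0 m] by metis
  thus "summable (harm_dirichlet_term m z)"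
    using z by (auto simp: sums_iff)
next
  obtain F where F_eq: "\<And>z. Re z > 1 \<Longrightarrow> F z = harm_dirichlet m z"
    and F: "\<And>z0. \<exists>N g. Re z0 > - real N \<and> g analytic_on {z0} \<and>
           (\<forall>\<^sub>F z in nhds z0. F z = (\<Sum>k\<le>Suc N. polar_part m k z) + g z)"
    using harm_dirichlet_continuation[of m] by blast
  \<comment> \<open>The largest power J of the logarithm accompanying n^(-k) determines the order J
    + 1.\<close>
  have pole: "has_pole_of_order F (1 - of_nat k) (Suc J)"
    if J: "J \<le> m" "harm_coeff m J k \<noteq> 0" "\<And>j. J < j \<Longrightarrow> j \<le> m \<Longrightarrow> harm_coeff m j k = 0" for k J
  proof -
    obtain g where g: "g analytic_on {1 - of_nat k}"
      "\<forall>\<^sub>F z in nhds (1 - of_nat k). F z = polar_part m k z + g z"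
      using polar_part_isolated[OF F, of k] by blast
    have "\<forall>\<^sub>F z in at (1 - of_nat k). F z =
        (\<Sum>j\<le>m. of_real (harm_coeff m j k) * fact j / (z - (1 - of_nat k)) ^ Suc j) + g z"
      using g(2) unfolding polar_part_def eventually_at_filter by (rule eventually_mono) simp
    from is_pole_zorder_polar_part[OF g(1) this J(1)]
    have "is_pole F (1 - of_nat k) \<and> zorder F (1 - of_nat k) = - int (Suc J)"
      using J(2,3) by simp
    thus ?thesis by (simp add: has_pole_of_order_def)
  qed
  \<comment> \<open>This covers m = 1 at the negative even integers, where the asserted order is
    0.\<close>
  have regular: "has_pole_of_order F (1 - of_nat k) 0"
    if zero: "\<And>j. j \<le> m \<Longrightarrow> harm_coeff m j k = 0" for k
  proof -
    obtain g where g: "g analytic_on {1 - of_nat k}"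
      "\<forall>\<^sub>F z in nhds (1 - of_nat k). F z = polar_part m k z + g z"
      using polar_part_isolated[OF F, of k] by blast
    have "polar_part m k z = 0" for z
      using zero by (simp add: polar_part_def)
    with g show ?thesis
      using analytic_at_cong[OF g(2) refl] by (simp add: has_pole_of_order_def)
  qed
  have beyond: "j = m" if "m - 1 < j" "j \<le> m" for j using that by auto
  \<comment> \<open>For k > 0 the power (ln n)^m is absent, and (ln n)^(m-1) comes with coefficient
    m a_k.\<close>
  have second: "has_pole_of_order F (1 - of_nat k) m" if "k > 0" "harm_fps $ k \<noteq> 0" for k
    using pole[of "m - 1" k] that assms harm_coeff_second[OF assms, of k] beyond harm_coeff_top(2)
    by fastforce
  have "F meromorphic_on {z0}" for z0
  proof -
    obtain N g where g: "g analytic_on {z0}"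
        "\<forall>\<^sub>F z in nhds z0. F z = (\<Sum>k\<le>Suc N. polar_part m k z) + g z"
      using F by blast
    have "(\<lambda>z. (\<Sum>k\<le>Suc N. polar_part m k z) + g z) meromorphic_on {z0}"
      by (intro meromorphic_intros polar_part_meromorphic analytic_on_imp_meromorphic_on g)
    moreover have "\<forall>\<^sub>F z in at z0. F z = (\<Sum>k\<le>Suc N. polar_part m k z) + g z"
      using g(2) by (auto simp: eventually_at_filter elim: eventually_mono)
    ultimately show ?thesis
      by (subst meromorphic_on_cong[OF _ refl]) auto
  qed
  hence "F meromorphic_on UNIV"
    by (subst meromorphic_on_meromorphic_at) auto
  moreover have "F analytic_on (- insert 1 (range (\<lambda>k::nat. - of_nat k)))"
  proof (subst analytic_on_analytic_at, rule ballI)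
    fix z0 :: complex assume z0: "z0 \<in> - insert 1 (range (\<lambda>k::nat. - of_nat k))"
    have "z0 \<noteq> 1 - of_nat k" for k
    proof (cases k)
      case (Suc k')
      thus ?thesis using z0 by auto
    qed (use z0 in auto)
    moreover obtain N g where g: "g analytic_on {z0}"
        "\<forall>\<^sub>F z in nhds z0. F z = (\<Sum>k\<le>Suc N. polar_part m k z) + g z"
      using F by blast
    ultimately have "(\<lambda>z. (\<Sum>k\<le>Suc N. polar_part m k z) + g z) analytic_on {z0}"
      by (intro analytic_intros polar_part_analytic) auto
    thus "F analytic_on {z0}"
      using analytic_at_cong[OF g(2) refl] by simp
  qed
  moreover have "has_pole_of_order F 1 (m + 1)"
    using pole[of m 0] by (simp add: harm_coeff_top)
  moreover have "has_pole_of_order F 0 m"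
    using second[of 1] harm_fps_1 by simp
  moreover have "has_pole_of_order F (- of_nat k) m" if "odd k" for k
    using second[of "Suc k"] harm_fps_even[of "Suc k"] that by simp
  moreover have "has_pole_of_order F (- of_nat k) (m - 1)" if k: "even k" "k > 0" for k
  proof -
    \<comment> \<open>The point -k corresponds to the expansion index k + 1, which is odd and
      greater than 1, so the powers m and m - 1 of the logarithm both drop out.\<close>
    have "harm_fps $ Suc k = 0"
      using k by (intro harm_fps_odd) auto
    hence zero: "harm_coeff m j (Suc k) = 0" if "m - 1 \<le> j" "j \<le> m" for j
      using that harm_coeff_top(2)[of "Suc k" m] harm_coeff_second[OF assms, of "Suc k"]
      by (cases "j = m") (auto dest: antisym simp: le_eq_less_or_eq dest: beyond)
    show ?thesis
    proof (cases "m = 1")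
      case True
      hence "has_pole_of_order F (1 - of_nat (Suc k)) 0"
        by (intro regular zero) auto
      thus ?thesis using True by simp
    next
      case False
      hence m: "m \<ge> 2" using assms by simp
      \<comment> \<open>The next candidate is (ln n)^(m-2), whose coefficient comes from the square
        of A_n.\<close>
      have "has_pole_of_order F (1 - of_nat (Suc k)) (Suc (m - 2))"
      proof (rule pole)
        show "harm_coeff m (m - 2) (Suc k) \<noteq> 0"
          using m k by (intro harm_coeff_third_nonzero) auto
      qed (use m zero in auto)
      moreover have "Suc (m - 2) = m - 1" using m by simp
      ultimately show ?thesis by simp
    qed
  qed
  ultimately show "\<exists>F :: complex \<Rightarrow> complex.
       F meromorphic_on UNIV \<and>
       (\<forall>z. Re z > 1 \<longrightarrow> F z = harm_dirichlet m z) \<and>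
       F analytic_on (- insert 1 (range (\<lambda>k::nat. - of_nat k))) \<and>
       has_pole_of_order F 1 (m + 1) \<and>
       has_pole_of_order F 0 m \<and>
       (\<forall>k::nat. odd k \<longrightarrow> has_pole_of_order F (- of_nat k) m) \<and>
       (\<forall>k::nat. even k \<and> k > 0 \<longrightarrow> has_pole_of_order F (- of_nat k) (m - 1))"
    using F_eq by blast
qed

end
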